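(* Let $\nu=w\mu$ with $w$ a probability density w.r.t. $\mu$ satisfying $w\ge\alpha w_m$ for some $\alpha>0$, and let $(x_1,\dots,x_n)\sim\nu^{\otimes n}$, using weighted least squares with weight $w$. Let $0<\delta<1$, $0<\eta<1$ and assume $$n\ge c_\delta^{-1}\alpha^{-1}m\log(m\eta^{-1}).$$ Then $S_\delta=\{\lambda_{\min}(\mathbf G^w)\ge1-\delta\}$ satisfies $\mathbb P(S_\delta)\ge1-\eta$, and for every $f\in L^2_\mu$, with $\hat f_m=\hat P_{V_m}f$, $$\mathbb E(\|f-\hat f_m\|^2\mid S_\delta)\le\big(1+(1-\eta)^{-1}(1-\delta)^{-1}\big)\inf_{g\in V_m}\|f-g\|^2,$$ and $$\mathbb E(\|f-\hat f_m\|^2\mid S_\delta)\le\Big(1+\alpha^{-1}\frac mn(1-\eta)^{-1}(1-\delta)^{-2}\Big)\inf_{g\in V_m}\|f-g\|^2.$$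
   Context: $\mathcal X$ is a Polish space with Borel probability measure $\mu$; $\|\cdot\|$ is the $L^2_\mu$ norm. $V_m\subset L^2_\mu$ has $L^2_\mu$-orthonormal basis $\varphi_1,\dots,\varphi_m$, $\boldsymbol\varphi=(\varphi_1,\dots,\varphi_m)^T$. $w_m(x)=\frac1m\|\boldsymbol\varphi(x)\|_2^2$ (a probability density w.r.t. $\mu$). For points $x_i$ and weight $w$: $\|f\|_n^2=\frac1n\sum_iw(x_i)^{-1}f(x_i)^2$, $\mathbf G^w=\frac1n\sum_iw(x_i)^{-1}\boldsymbol\varphi(x_i)\boldsymbol\varphi(x_i)^T$, and $\hat P_{V_m}f$ (defined when $\mathbf G^w$ is invertible) is the unique minimizer of $\|f-g\|_n$ over $g\in V_m$. $c_\delta=\delta+(1-\delta)\log(1-\delta)$. *)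

theory Defs
  imports "HOL-Probability.Probability"
begin

text \<open>Basis functions phi 0, ..., phi (m-1) (the paper's phi_1..phi_m); sample points
  are xs 0, ..., xs (n-1).\<close>

definition Vm :: "(nat \<Rightarrow> 'a \<Rightarrow> real) \<Rightarrow> nat \<Rightarrow> ('a \<Rightarrow> real) set" where
  "Vm \<phi> m = {g. \<exists>c::nat \<Rightarrow> real. g = (\<lambda>x. \<Sum>j<m. c j * \<phi> j x)}"

definition wm :: "(nat \<Rightarrow> 'a \<Rightarrow> real) \<Rightarrow> nat \<Rightarrow> 'a \<Rightarrow> real" where
  "wm \<phi> m x = (1 / real m) * (\<Sum>j<m. (\<phi> j x)\<^sup>2)"

definition L2sq :: "'a measure \<Rightarrow> ('a \<Rightarrow> real) \<Rightarrow> real" where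
  "L2sq M g = (\<integral>x. (g x)\<^sup>2 \<partial>M)"

definition emp_sq :: "('a \<Rightarrow> real) \<Rightarrow> nat \<Rightarrow> (nat \<Rightarrow> 'a) \<Rightarrow> ('a \<Rightarrow> real) \<Rightarrow> real" where
  "emp_sq w n xs g = (1 / real n) * (\<Sum>i<n. (g (xs i))\<^sup>2 / w (xs i))"

definition gram :: "('a \<Rightarrow> real) \<Rightarrow> (nat \<Rightarrow> 'a \<Rightarrow> real) \<Rightarrow> nat \<Rightarrow> (nat \<Rightarrow> 'a) \<Rightarrow> nat \<Rightarrow> nat \<Rightarrow> real" where
  "gram w \<phi> n xs j k = (1 / real n) * (\<Sum>i<n. \<phi> j (xs i) * \<phi> k (xs i) / w (xs i))"

definition eigenvalues_mat :: "nat \<Rightarrow> (nat \<Rightarrow> nat \<Rightarrow> real) \<Rightarrow> real set" where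
  "eigenvalues_mat m A = {l. \<exists>c::nat \<Rightarrow> real. (\<exists>j<m. c j \<noteq> 0) \<and>
        (\<forall>j<m. (\<Sum>k<m. A j k * c k) = l * c j)}"

definition lambda_min :: "nat \<Rightarrow> (nat \<Rightarrow> nat \<Rightarrow> real) \<Rightarrow> real" where
  "lambda_min m A = Min (eigenvalues_mat m A)"

definition hatP :: "('a \<Rightarrow> real) \<Rightarrow> (nat \<Rightarrow> 'a \<Rightarrow> real) \<Rightarrow> nat \<Rightarrow> nat \<Rightarrow> (nat \<Rightarrow> 'a)
     \<Rightarrow> ('a \<Rightarrow> real) \<Rightarrow> ('a \<Rightarrow> real)" where
  "hatP w \<phi> m n xs f = (THE g. g \<in> Vm \<phi> m \<and>
      (\<forall>h\<in>Vm \<phi> m. emp_sq w n xs (\<lambda>x. f x - g x) \<le> emp_sq w n xs (\<lambda>x. f x - h x)))"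

definition c_delta :: "real \<Rightarrow> real" where
  "c_delta \<delta> = \<delta> + (1 - \<delta>) * ln (1 - \<delta>)"

definition cond_exp :: "'b measure \<Rightarrow> 'b set \<Rightarrow> ('b \<Rightarrow> real) \<Rightarrow> ennreal" where
  "cond_exp P S X = (\<integral>\<^sup>+ y. ennreal (X y) * indicator S y \<partial>P) / emeasure P S"

end

theory Submission
  imports Defs "Jordan_Normal_Form.Spectral_Radius" "HOL-Real_Asymp.Real_Asymp"
begin

text \<open>
  Concentration of the Gram matrix follows the Ahlswede--Winter scheme, but without matrix
  exponentials or the spectral theorem: \<open>tr exp (- \<theta> S)\<close> is replaced by
  \<open>tr (1 - \<epsilon> S)^k\<close> with \<open>\<epsilon> = \<theta> / k\<close>, \<open>k = 2 p + 1\<close>, and \<open>p\<close> tends to infinity at the very end. The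
  Golden--Thompson inequality is needed only for the rank-one summands \<open>v v\<^sup>T\<close>. With
  \<open>A t = 1 - \<epsilon> (S + t v v\<^sup>T)\<close>, the trace of \<open>(A t)^k\<close> has derivative \<open>- \<epsilon> k h t\<close> where
  \<open>h t = v \<bullet> (A t)^(k - 1) v\<close>, and the log-convexity of the moments \<open>v \<bullet> (A t)^i v\<close> gives
  \<open>h' \<ge> - \<kappa> |v|\<^sup>2 h\<close> with \<open>\<kappa>\<close> close to \<open>\<theta>\<close>; integrating over \<open>[0, 1]\<close> yields the one-step decrease of the
  trace, which is averaged using that \<open>v v\<^sup>T\<close> has expectation \<open>1\<close>.

  On the event \<open>S\<^sub>\<delta>\<close>, the least squares error splits as \<open>|g|\<^sup>2 + |d|\<^sup>2\<close>, where \<open>g\<close> is the residual of the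
  orthogonal projection and \<open>d\<close> solves the normal equations for \<open>g\<close>. The two estimates come from
  bounding \<open>|d|\<^sup>2\<close> by the empirical norm of \<open>g\<close>, respectively by the right-hand side of the normal
  equations, whose entries are averages of independent centred variables.
\<close>

section \<open>Matrices acting on real vectors\<close>

text \<open>The dimension \<open>m\<close> is a number rather than a type, so vectors and matrices are functions of
  which only the values at indices below \<open>m\<close> matter.\<close>

definition dot :: "nat \<Rightarrow> (nat \<Rightarrow> real) \<Rightarrow> (nat \<Rightarrow> real) \<Rightarrow> real" where
  "dot m u v = (\<Sum>j<m. u j * v j)"

definition mv :: "nat \<Rightarrow> (nat \<Rightarrow> nat \<Rightarrow> real) \<Rightarrow> (nat \<Rightarrow> real) \<Rightarrow> nat \<Rightarrow> real" where
  "mv m A u = (\<lambda>j. \<Sum>k<m. A j k * u k)"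

text \<open>Powers are iterated applications to a vector. The zeroth power also leaves the entries
  from \<open>m\<close> on unchanged, so identities such as \<open>mpow_expand\<close> are stated
  pointwise below \<open>m\<close>.\<close>

definition mpow :: "nat \<Rightarrow> (nat \<Rightarrow> nat \<Rightarrow> real) \<Rightarrow> nat \<Rightarrow> (nat \<Rightarrow> real) \<Rightarrow> nat \<Rightarrow> real" where
  "mpow m A k = (mv m A ^^ k)"

definition std_vec :: "nat \<Rightarrow> nat \<Rightarrow> real" where
  "std_vec q = (\<lambda>j. if j = q then 1 else 0)"

definition tr_pow :: "nat \<Rightarrow> (nat \<Rightarrow> nat \<Rightarrow> real) \<Rightarrow> nat \<Rightarrow> real" where
  "tr_pow m A k = (\<Sum>q<m. dot m (std_vec q) (mpow m A k (std_vec q)))"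

definition symm :: "nat \<Rightarrow> (nat \<Rightarrow> nat \<Rightarrow> real) \<Rightarrow> bool" where
  "symm m A \<longleftrightarrow> (\<forall>j<m. \<forall>k<m. A j k = A k j)"

definition psd :: "nat \<Rightarrow> (nat \<Rightarrow> nat \<Rightarrow> real) \<Rightarrow> bool" where
  "psd m A \<longleftrightarrow> symm m A \<and> (\<forall>u. 0 \<le> dot m u (mv m A u))"

lemma dot_commute: "dot m u v = dot m v u"
  by (simp add: dot_def mult.commute)

lemma dot_add_right: "dot m u (\<lambda>j. v j + w j) = dot m u v + dot m u w"
  by (simp add: dot_def algebra_simps sum.distrib)

lemma dot_add_left: "dot m (\<lambda>j. v j + w j) u = dot m v u + dot m w u"
  by (simp add: dot_def algebra_simps sum.distrib)

lemma dot_scale_right: "dot m u (\<lambda>j. c * v j) = c * dot m u v"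
  by (simp add: dot_def sum_distrib_left algebra_simps)

lemma dot_scale_left: "dot m (\<lambda>j. c * v j) u = c * dot m v u"
  by (simp add: dot_def sum_distrib_left algebra_simps)

lemma dot_self_nonneg [simp]: "0 \<le> dot m u u"
  by (simp add: dot_def sum_nonneg)

lemma dot_cong:
  "(\<And>j. j < m \<Longrightarrow> u j = u' j) \<Longrightarrow> (\<And>j. j < m \<Longrightarrow> v j = v' j) \<Longrightarrow> dot m u v = dot m u' v'"
  by (simp add: dot_def)

lemma dot_std_vec_left: "q < m \<Longrightarrow> dot m (std_vec q) u = u q"
  by (simp add: dot_def std_vec_def if_distrib[of "\<lambda>c. c * _"] cong: if_cong)

lemma dot_std_vec_right: "q < m \<Longrightarrow> dot m u (std_vec q) = u q"
  by (simp add: dot_commute[of m u] dot_std_vec_left)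

lemma mv_add: "mv m A (\<lambda>j. u j + v j) = (\<lambda>j. mv m A u j + mv m A v j)"
  by (simp add: mv_def algebra_simps sum.distrib)

lemma mv_scale: "mv m A (\<lambda>j. c * u j) = (\<lambda>j. c * mv m A u j)"
  by (simp add: mv_def sum_distrib_left algebra_simps)

lemma mv_cong: "(\<And>j. j < m \<Longrightarrow> u j = v j) \<Longrightarrow> mv m A u = mv m A v"
  by (simp add: mv_def)

lemma dot_mv_sym:
  assumes "symm m A"
  shows "dot m (mv m A u) v = dot m u (mv m A v)"
proof -
  have "dot m (mv m A u) v = (\<Sum>j<m. \<Sum>k<m. A j k * u k * v j)"
    by (simp add: dot_def mv_def sum_distrib_right)
  also have "\<dots> = (\<Sum>k<m. \<Sum>j<m. A j k * u k * v j)"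
    by (rule sum.swap)
  also have "\<dots> = (\<Sum>k<m. \<Sum>j<m. u k * (A k j * v j))"
    using assms by (intro sum.cong refl) (simp add: symm_def)
  also have "\<dots> = dot m u (mv m A v)"
    by (simp add: dot_def mv_def sum_distrib_left)
  finally show ?thesis .
qed

lemma mpow_0 [simp]: "mpow m A 0 u = u"
  by (simp add: mpow_def)

lemma mpow_Suc [simp]: "mpow m A (Suc k) u = mv m A (mpow m A k u)"
  by (simp add: mpow_def)

text \<open>Self-adjointness moves the factors across one at a time. Read from right to left, this
  splits a moment of even order into a squared norm and one of odd order into the form of
  \<open>A\<close> at a single vector.\<close>

lemma dot_mpow:
  assumes "symm m A"
  shows "dot m (mpow m A i u) (mpow m A j v) = dot m u (mpow m A (i + j) v)"
proof (induction i arbitrary: j)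
  case (Suc i)
  have "dot m (mpow m A (Suc i) u) (mpow m A j v) = dot m (mpow m A i u) (mpow m A (Suc j) v)"
    using dot_mv_sym[OF assms] by simp
  also have "\<dots> = dot m u (mpow m A (i + Suc j) v)" by (rule Suc)
  finally show ?case by simp
qed simp

lemma quadratic_nonneg_imp_discriminant:
  fixes a b c :: real
  assumes "\<And>t. 0 \<le> a + 2 * t * b + t\<^sup>2 * c"
  shows "b\<^sup>2 \<le> a * c"
proof (cases "c = 0")
  case True
  have "b = 0"
  proof (rule ccontr)
    assume "b \<noteq> 0"
    \<comment> \<open>At this \<open>t\<close> the polynomial takes the value -1.\<close>
    then show False using assms[of "- (a + 1) / (2 * b)"] True by (simp add: field_simps)
  qed
  then show ?thesis using True by (simp add: field_simps)
next
  case False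
  have "0 \<le> c"
  proof (rule ccontr)
    assume c: "\<not> 0 \<le> c"
    \<comment> \<open>The sign makes \<open>t * b\<close> nonpositive, and the modulus makes
      \<open>t\<^sup>2 * c\<close> at most \<open>c - \<bar>a\<bar>\<close>, so the polynomial is
      negative at \<open>t\<close>.\<close>
    define t where "t = (if b \<le> 0 then 1 else -1) * (1 + \<bar>a\<bar> / -c)"
    have t2: "t\<^sup>2 \<ge> 1 + \<bar>a\<bar> / -c"
    proof -
      have "1 \<le> 1 + \<bar>a\<bar> / -c" using c by (simp add: divide_nonneg_neg)
      then have "1 + \<bar>a\<bar> / -c \<le> (1 + \<bar>a\<bar> / -c)\<^sup>2"
        by (metis dual_order.trans mult_left_mono mult.right_neutral power2_eq_square zero_le_one)
      then show ?thesis by (simp add: t_def power_mult_distrib)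
    qed
    have "t * b \<le> 0" using c
      by (auto simp: t_def mult_le_0_iff divide_nonneg_neg zero_le_mult_iff add_nonneg_nonneg)
    moreover have "t\<^sup>2 * c \<le> (1 + \<bar>a\<bar> / -c) * c" using c t2 by (intro mult_right_mono_neg) auto
    moreover have "(1 + \<bar>a\<bar> / -c) * c = c - \<bar>a\<bar>" using c by (simp add: field_simps)
    ultimately show False using assms[of t] c by linarith
  qed
  then have "c > 0" using False by simp
  then show ?thesis using assms[of "- b / c"]
    by (simp add: field_simps power2_eq_square)
qed

text \<open>Along the line \<open>x + t y\<close> the form is a nonnegative quadratic polynomial in
  \<open>t\<close>. If the form vanishes at \<open>y\<close>, the inequality forces
  \<open>A y\<close> to vanish; this later turns a minimiser of the Rayleigh quotient into an
  eigenvector.\<close>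

lemma psd_Cauchy_Schwarz:
  assumes "psd m A"
  shows "(dot m x (mv m A y))\<^sup>2 \<le> dot m x (mv m A x) * dot m y (mv m A y)"
proof (rule quadratic_nonneg_imp_discriminant)
  fix t
  have s: "dot m y (mv m A x) = dot m x (mv m A y)"
    using assms dot_mv_sym[of m A x y] dot_commute by (metis psd_def)
  have "0 \<le> dot m (\<lambda>j. x j + t * y j) (mv m A (\<lambda>j. x j + t * y j))"
    using assms unfolding psd_def by blast
  also have "\<dots> = dot m x (mv m A x) + 2 * t * dot m x (mv m A y) + t\<^sup>2 * dot m y (mv m A y)"
    by (simp add: mv_add mv_scale dot_add_left dot_add_right dot_scale_left dot_scale_right s
        power2_eq_square algebra_simps)
  finally show "0 \<le> \<dots>" .
qed

lemma dot_Cauchy_Schwarz: "(dot m x y)\<^sup>2 \<le> dot m x x * dot m y y"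
proof (rule quadratic_nonneg_imp_discriminant)
  fix t
  have "0 \<le> dot m (\<lambda>j. x j + t * y j) (\<lambda>j. x j + t * y j)" by simp
  also have "\<dots> = dot m x x + 2 * t * dot m x y + t\<^sup>2 * dot m y y"
    by (simp add: dot_add_left dot_add_right dot_scale_left dot_scale_right
        dot_commute[of m y x] power2_eq_square algebra_simps)
  finally show "0 \<le> \<dots>" .
qed

section \<open>Log-convexity of moments\<close>

text \<open>Ratios of successive terms are nondecreasing; writing this with products avoids division
  by terms that may vanish.\<close>

lemma log_convex_ratio_mono:
  fixes a :: "nat \<Rightarrow> real"
  assumes nonneg: "\<And>i. 0 \<le> a i" and lc: "\<And>i. (a (Suc i))\<^sup>2 \<le> a i * a (Suc (Suc i))"
    and "j \<le> i"
  shows "a (Suc j) * a i \<le> a j * a (Suc i)"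
  using \<open>j \<le> i\<close>
proof (induction i rule: dec_induct)
  case (step i)
  show ?case
  proof (cases "a i = 0")
    case True
    \<comment> \<open>A zero term forces the next one to vanish, so the left side is 0.\<close>
    then have "a (Suc i) = 0" using lc[of i] by simp
    then show ?thesis using nonneg by simp
  next
    case False
    then have pos: "a i > 0" using nonneg[of i] by simp
    have "a i * (a (Suc j) * a (Suc i)) = (a (Suc j) * a i) * a (Suc i)" by simp
    also have "\<dots> \<le> (a j * a (Suc i)) * a (Suc i)"
      using step nonneg by (intro mult_right_mono) auto
    also have "\<dots> = a j * (a (Suc i))\<^sup>2" by (simp add: power2_eq_square)
    also have "\<dots> \<le> a j * (a i * a (Suc (Suc i)))" using lc nonneg by (intro mult_left_mono) auto
    finally have "a i * (a (Suc j) * a (Suc i)) \<le> a i * (a j * a (Suc (Suc i)))" by (simp add: ac_simps)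
    then show ?thesis using pos by simp
  qed
qed (simp add: mult.commute)

text \<open>Moving one unit from the smaller index to the larger one does not decrease the product;
  this is repeated until the smaller index is 0.\<close>

lemma log_convex_mult_le:
  fixes a :: "nat \<Rightarrow> real"
  assumes nonneg: "\<And>i. 0 \<le> a i" and lc: "\<And>i. (a (Suc i))\<^sup>2 \<le> a i * a (Suc (Suc i))"
  shows "a i * a j \<le> a 0 * a (i + j)"
proof -
  have le: "a i * a j \<le> a 0 * a (i + j)" if "i \<le> j" for i j
    using that
  proof (induction i arbitrary: j)
    case (Suc i)
    have "a (Suc i) * a j \<le> a i * a (Suc j)"
      using Suc.prems by (intro log_convex_ratio_mono nonneg lc) auto
    also have "\<dots> \<le> a 0 * a (i + Suc j)" using Suc.prems by (intro Suc.IH) auto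
    finally show ?case by simp
  qed simp
  show ?thesis
    using le[of i j] le[of j i] by (cases "i \<le> j") (auto simp: mult.commute add.commute)
qed

text \<open>The moment of order \<open>2 p\<close> is the squared norm of \<open>A^p v\<close>; that
  of order \<open>2 p + 1\<close> is the form of \<open>A\<close> at \<open>A^p v\<close>.\<close>

lemma psd_moment_nonneg:
  assumes "psd m A"
  shows "0 \<le> dot m v (mpow m A i v)"
proof (cases "even i")
  case True
  then obtain p where "i = p + p" by (metis evenE mult_2)
  then show ?thesis using dot_mpow[of m A p v p v] assms by (simp add: psd_def flip: dot_mpow)
next
  case False
  then obtain p where i: "i = p + Suc p" by (metis add_Suc_right mult_2 oddE Suc_eq_plus1)
  have "dot m v (mpow m A i v) = dot m (mpow m A p v) (mv m A (mpow m A p v))"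
    using dot_mpow[of m A p v "Suc p" v] assms i by (simp add: psd_def)
  then show ?thesis using assms by (simp add: psd_def)
qed

text \<open>Cauchy-Schwarz for \<open>A^p v\<close> and \<open>A^(p + 1) v\<close>: with the
  Euclidean inner product when \<open>i = 2 p\<close>, with the form of \<open>A\<close> when
  \<open>i = 2 p + 1\<close>.\<close>

lemma psd_moment_log_convex:
  assumes "psd m A"
  shows "(dot m v (mpow m A (Suc i) v))\<^sup>2 \<le> dot m v (mpow m A i v) * dot m v (mpow m A (Suc (Suc i)) v)"
proof -
  have sym: "symm m A" using assms by (simp add: psd_def)
  show ?thesis
  proof (cases "even i")
    case True
    then obtain p where i: "i = p + p" by (metis evenE mult_2)
    show ?thesis
      using dot_Cauchy_Schwarz[of m "mpow m A p v" "mpow m A (Suc p) v"]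
      unfolding dot_mpow[OF sym] i by simp
  next
    case False
    then obtain p where i: "i = p + Suc p" by (metis add_Suc_right mult_2 oddE Suc_eq_plus1)
    show ?thesis
      using psd_Cauchy_Schwarz[OF assms, of "mpow m A p v" "mpow m A (Suc p) v"]
      unfolding mpow_Suc[symmetric] dot_mpow[OF sym] i by simp
  qed
qed

lemma psd_moment_mult_le:
  assumes "psd m A"
  shows "dot m v (mpow m A i v) * dot m v (mpow m A j v) \<le> dot m v v * dot m v (mpow m A (i + j) v)"
  using log_convex_mult_le[of "\<lambda>i. dot m v (mpow m A i v)" i j]
    psd_moment_nonneg[OF assms] psd_moment_log_convex[OF assms] by simp

text \<open>Ratios of successive moments never fall below the first one, so a lower bound on the
  first ratio passes to all of them.\<close>

lemma psd_moment_Suc_ge: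
  assumes "psd m A" and ge: "a * dot m v v \<le> dot m v (mv m A v)"
  shows "a * dot m v (mpow m A i v) \<le> dot m v (mpow m A (Suc i) v)"
proof (cases "dot m v v = 0")
  case True
  then have "v j = 0" if "j < m" for j
    using that by (auto simp: dot_def sum_nonneg_eq_0_iff)
  then have "dot m v u = 0" for u by (simp add: dot_def)
  then show ?thesis by simp
next
  case False
  then have pos: "0 < dot m v v" using dot_self_nonneg[of m v] by linarith
  have "dot m v v * (a * dot m v (mpow m A i v)) = (a * dot m v v) * dot m v (mpow m A i v)" by simp
  also have "\<dots> \<le> dot m v (mpow m A 1 v) * dot m v (mpow m A i v)"
    using ge psd_moment_nonneg[OF assms(1)] by (intro mult_right_mono) auto
  also have "\<dots> \<le> dot m v v * dot m v (mpow m A (1 + i) v)"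
    by (rule psd_moment_mult_le[OF assms(1)])
  finally show ?thesis using pos by simp
qed

section \<open>Rank-one updates of the trace\<close>

text \<open>Product rule: differentiating one of the \<open>k\<close> factors puts
  \<open>- \<epsilon> v v^T\<close> in its place, with \<open>i\<close> factors to its left and
  \<open>k - 1 - i\<close> factors to its right.\<close>

lemma has_real_derivative_mpow_rank_one:
  fixes B :: "nat \<Rightarrow> nat \<Rightarrow> real" and v :: "nat \<Rightarrow> real" and \<epsilon> :: real
  defines "A \<equiv> \<lambda>t j k. B j k - t * \<epsilon> * (v j * v k)"
  shows "((\<lambda>t. mpow m (A t) k u j) has_real_derivative
     (- \<epsilon> * (\<Sum>i<k. dot m v (mpow m (A t) (k - 1 - i) u) * mpow m (A t) i v j))) (at t)"
proof (induction k arbitrary: j)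
  case (Suc k)
  define D where "D l = - \<epsilon> * (\<Sum>i<k. dot m v (mpow m (A t) (k - 1 - i) u) * mpow m (A t) i v l)" for l
  have [derivative_intros]: "((\<lambda>t. A t j l) has_real_derivative (- \<epsilon> * (v j * v l))) (at t)" for l
    unfolding A_def by (auto intro!: derivative_eq_intros)
  have [derivative_intros]: "((\<lambda>t. mpow m (A t) k u l) has_real_derivative D l) (at t)" for l
    unfolding D_def by (rule Suc.IH)
  have d: "((\<lambda>t. \<Sum>l<m. A t j l * mpow m (A t) k u l) has_real_derivative
      (\<Sum>l<m. (- \<epsilon> * (v j * v l)) * mpow m (A t) k u l + D l * A t j l)) (at t)"
    by (auto intro!: derivative_eq_intros simp: ac_simps)
  \<comment> \<open>The outermost factor yields the summand \<open>i = 0\<close> of the new sum; the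
    inner factors yield the others, with the index shifted by one.\<close>
  have e1: "(\<Sum>l<m. (- \<epsilon> * (v j * v l)) * mpow m (A t) k u l + D l * A t j l)
      = - \<epsilon> * (dot m v (mpow m (A t) k u) * v j) + (\<Sum>l<m. D l * A t j l)"
    by (simp add: sum.distrib dot_def sum_distrib_left sum_distrib_right ac_simps sum_negf sum_subtractf)
  have e2: "(\<Sum>l<m. D l * A t j l) =
      - \<epsilon> * (\<Sum>i<k. dot m v (mpow m (A t) (k - 1 - i) u) * mpow m (A t) (Suc i) v j)"
    unfolding D_def mpow_Suc mv_def
    by (simp add: sum_distrib_left sum_distrib_right ac_simps sum_negf sum.swap[of _ "{..<m}"])
  have e3: "(\<Sum>i<Suc k. dot m v (mpow m (A t) (Suc k - 1 - i) u) * mpow m (A t) i v j)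
     = dot m v (mpow m (A t) k u) * v j +
       (\<Sum>i<k. dot m v (mpow m (A t) (k - 1 - i) u) * mpow m (A t) (Suc i) v j)"
    by (subst sum.lessThan_Suc_shift) simp
  have e: "(\<Sum>l<m. (- \<epsilon> * (v j * v l)) * mpow m (A t) k u l + D l * A t j l)
     = - \<epsilon> * (\<Sum>i<Suc k. dot m v (mpow m (A t) (Suc k - 1 - i) u) * mpow m (A t) i v j)"
    by (simp only: e1 e2 e3 distrib_left)
  have "(\<lambda>t. mpow m (A t) (Suc k) u j) = (\<lambda>t. \<Sum>l<m. A t j l * mpow m (A t) k u l)"
    by (simp add: mv_def)
  with d show ?case unfolding e by (simp only:)
qed (simp add: A_def)

text \<open>Cyclic invariance of the trace for a product containing one factor \<open>v v^T\<close>.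
  It makes all summands in the derivative of the trace equal to the same moment.\<close>

lemma sum_dot_mpow_std_vec:
  assumes "symm m A"
  shows "(\<Sum>q<m. dot m v (mpow m A r (std_vec q)) * mpow m A i v q) = dot m v (mpow m A (r + i) v)"
proof -
  have "dot m v (mpow m A r (std_vec q)) = mpow m A r v q" if "q < m" for q
    using dot_mpow[OF assms, of r v 0 "std_vec q"] that by (simp add: dot_std_vec_right)
  then have "(\<Sum>q<m. dot m v (mpow m A r (std_vec q)) * mpow m A i v q)
      = dot m (mpow m A r v) (mpow m A i v)" by (simp add: dot_def)
  then show ?thesis by (simp add: dot_mpow[OF assms])
qed

text \<open>A Gronwall argument gives \<open>h t \<ge> h 0 * exp (- \<kappa> * s * t)\<close> on
  [0, 1]; the subtracted term is \<theta> times the integral of this lower bound.\<close>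

lemma rank_one_decay:
  fixes f h :: "real \<Rightarrow> real"
  assumes f: "\<And>t. (f has_real_derivative (- \<theta> * h t)) (at t)"
    and h: "\<And>t. (h has_real_derivative h' t) (at t)"
    and h': "\<And>t. 0 \<le> t \<Longrightarrow> t \<le> 1 \<Longrightarrow> - (\<kappa> * s) * h t \<le> h' t"
    and pos: "\<kappa> > 0" "s > 0" "\<theta> \<ge> 0"
  shows "f 1 \<le> f 0 - \<theta> / \<kappa> * ((1 - exp (- \<kappa> * s)) / s) * h 0"
proof -
  have low: "h 0 * exp (- (\<kappa> * s) * t) \<le> h t" if "0 \<le> t" "t \<le> 1" for t
  proof -
    \<comment> \<open>The integrating factor makes the product nondecreasing.\<close>
    have "h 0 * exp (\<kappa> * s * 0) \<le> h t * exp (\<kappa> * s * t)"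
    proof (rule DERIV_nonneg_imp_nondecreasing[OF that(1)], intro exI conjI)
      fix x assume x: "0 \<le> x" "x \<le> t"
      show "((\<lambda>t. h t * exp (\<kappa> * s * t)) has_real_derivative
          (h' x + \<kappa> * s * h x) * exp (\<kappa> * s * x)) (at x)"
        by (auto intro!: derivative_eq_intros h simp: algebra_simps)
      show "0 \<le> (h' x + \<kappa> * s * h x) * exp (\<kappa> * s * x)"
        using h'[of x] x that by (intro mult_nonneg_nonneg) auto
    qed
    then have "h 0 * exp (- (\<kappa> * s) * t) \<le> (h t * exp (\<kappa> * s * t)) * exp (- (\<kappa> * s) * t)"
      by (intro mult_right_mono) auto
    then show ?thesis by (simp add: mult.assoc flip: exp_add)
  qed
  \<comment> \<open>Integration is replaced by an antiderivative: the lower bound on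
    \<open>h\<close> says that this difference has nonpositive derivative.\<close>
  have "f 1 - \<theta> / \<kappa> / s * h 0 * exp (- (\<kappa> * s) * 1) \<le> f 0 - \<theta> / \<kappa> / s * h 0 * exp (- (\<kappa> * s) * 0)"
  proof (rule DERIV_nonpos_imp_nonincreasing, simp, intro exI conjI)
    fix x :: real assume x: "0 \<le> x" "x \<le> 1"
    show "((\<lambda>t. f t - \<theta> / \<kappa> / s * h 0 * exp (- (\<kappa> * s) * t)) has_real_derivative
        - \<theta> * (h x - h 0 * exp (- (\<kappa> * s) * x))) (at x)"
      using pos by (auto intro!: derivative_eq_intros f simp: algebra_simps)
    show "- \<theta> * (h x - h 0 * exp (- (\<kappa> * s) * x)) \<le> 0"
      using low[OF x] pos by (simp add: mult_le_0_iff)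
  qed
  then show ?thesis by (simp add: algebra_simps diff_divide_distrib)
qed

definition shifted :: "real \<Rightarrow> (nat \<Rightarrow> nat \<Rightarrow> real) \<Rightarrow> nat \<Rightarrow> nat \<Rightarrow> real" where
  "shifted \<epsilon> S = (\<lambda>j k. (if j = k then 1 else 0) - \<epsilon> * S j k)"

lemma symm_shifted: "symm m S \<Longrightarrow> symm m (shifted \<epsilon> S)"
  by (simp add: symm_def shifted_def)

lemma mv_shifted: "j < m \<Longrightarrow> mv m (shifted \<epsilon> S) u j = u j - \<epsilon> * mv m S u j"
  by (simp add: mv_def shifted_def left_diff_distrib sum_subtractf sum_distrib_left mult.assoc
      if_distrib[of "\<lambda>c. c * _"] cong: if_cong)

lemma dot_mv_shifted: "dot m u (mv m (shifted \<epsilon> S) u) = dot m u u - \<epsilon> * dot m u (mv m S u)"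
proof -
  have "dot m u (mv m (shifted \<epsilon> S) u) = dot m u (\<lambda>j. u j + (- \<epsilon>) * mv m S u j)"
    by (intro dot_cong) (simp_all add: mv_shifted)
  then show ?thesis by (simp add: dot_add_right[of m u u "\<lambda>j. (- \<epsilon>) * mv m S u j", unfolded dot_scale_right, simplified])
qed

text \<open>An upper bound on \<open>S\<close> keeps \<open>1 - \<epsilon> S\<close> above
  \<open>a\<close>. Later \<open>a\<close> tends to 1 as \<epsilon> tends to 0, so it disappears in
  the limit.\<close>

lemma dot_mv_shifted_ge:
  assumes "\<And>u. dot m u (mv m S u) \<le> L * dot m u u" "\<epsilon> * L \<le> 1 - a" "0 \<le> \<epsilon>"
  shows "a * dot m u u \<le> dot m u (mv m (shifted \<epsilon> S) u)"
proof -
  have "\<epsilon> * dot m u (mv m S u) \<le> \<epsilon> * (L * dot m u u)"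
    using assms by (intro mult_left_mono) auto
  also have "\<dots> = (\<epsilon> * L) * dot m u u" by simp
  also have "\<dots> \<le> (1 - a) * dot m u u" using assms by (intro mult_right_mono) auto
  finally show ?thesis unfolding dot_mv_shifted by (simp add: algebra_simps)
qed

lemma mv_add_rank_one:
  "mv m (\<lambda>j k. S j k + t * (v j * v k)) u = (\<lambda>j. mv m S u j + (t * dot m v u) * v j)"
  by (simp add: mv_def dot_def algebra_simps sum.distrib sum_distrib_left)

lemma dot_mv_add_rank_one:
  "dot m u (mv m (\<lambda>j k. S j k + t * (v j * v k)) u) = dot m u (mv m S u) + t * (dot m v u)\<^sup>2"
  unfolding mv_add_rank_one dot_add_right dot_scale_right
  by (simp add: dot_commute[of m u v] power2_eq_square)

text \<open>Convexity of \<open>exp\<close> on the segment from 0 to \<open>- \<kappa> * R\<close>,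
  at the fraction \<open>s / R\<close>. It lets the squared norm of a sample be replaced by its
  bound \<open>R\<close>.\<close>

lemma one_minus_exp_div_antimono:
  fixes \<kappa> s R :: real
  assumes "0 < s" "s \<le> R"
  shows "(1 - exp (- \<kappa> * R)) / R \<le> (1 - exp (- \<kappa> * s)) / s"
proof -
  have R: "R > 0" using assms by simp
  have "exp ((1 - s / R) *\<^sub>R 0 + (s / R) *\<^sub>R (- \<kappa> * R)) \<le> (1 - s / R) * exp 0 + (s / R) * exp (- \<kappa> * R)"
    using assms R by (intro convex_onD[OF exp_convex]) auto
  then have "exp (- \<kappa> * s) \<le> 1 - s / R * (1 - exp (- \<kappa> * R))"
    using R by (simp add: algebra_simps)
  then show ?thesis using assms R by (simp add: field_simps)
qed

text \<open>Follow the path \<open>S + t v v^T\<close> and apply \<open>rank_one_decay\<close> with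
  the trace as \<open>f\<close>, the moment of order \<open>2 p\<close> as \<open>h\<close>,
  \<open>s = |v|^2\<close> and \<open>\<kappa> = \<theta> / a\<close>.\<close>

lemma tr_pow_add_rank_one:
  fixes p :: nat
  assumes S: "psd m S"
    and bound: "\<And>u. dot m u (mv m S u) + (dot m v u)\<^sup>2 \<le> L * dot m u u"
    and a: "0 < a" "\<epsilon> * L \<le> 1 - a" and eps: "0 < \<epsilon>"
    and R: "dot m v v \<le> R"
  defines "\<theta> \<equiv> \<epsilon> * real (Suc (2 * p))"
  shows "tr_pow m (shifted \<epsilon> (\<lambda>j k. S j k + v j * v k)) (Suc (2 * p))
    \<le> tr_pow m (shifted \<epsilon> S) (Suc (2 * p))
        - a * ((1 - exp (- (\<theta> / a) * R)) / R) * dot m v (mpow m (shifted \<epsilon> S) (2 * p) v)"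
proof -
  define A where "A t = (\<lambda>j k. shifted \<epsilon> S j k - t * \<epsilon> * (v j * v k))" for t
  have A_eq: "A t = shifted \<epsilon> (\<lambda>j k. S j k + t * (v j * v k))" for t
    by (auto simp: A_def shifted_def algebra_simps)
  have A0: "A 0 = shifted \<epsilon> S" and A1: "A 1 = shifted \<epsilon> (\<lambda>j k. S j k + v j * v k)"
    by (simp_all add: A_eq)
  have theta: "\<theta> > 0" using eps by (simp add: \<theta>_def)
  have symS: "symm m S" using S by (simp add: psd_def)
  then have "symm m (\<lambda>j k. S j k + t * (v j * v k))" for t
    by (simp add: symm_def mult.commute)
  then have sym: "symm m (A t)" for t unfolding A_eq by (rule symm_shifted)
  \<comment> \<open>For \<open>t\<close> in [0, 1] the path stays below its endpoint
    \<open>S + v v^T\<close>, so the bound \<open>L\<close> holds throughout.\<close>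
  have ge: "a * dot m u u \<le> dot m u (mv m (A t) u)" if "0 \<le> t" "t \<le> 1" for t u
    unfolding A_eq
  proof (rule dot_mv_shifted_ge[OF _ a(2)])
    show "dot m u (mv m (\<lambda>j k. S j k + t * (v j * v k)) u) \<le> L * dot m u u" for u
    proof -
      have "t * (dot m v u)\<^sup>2 \<le> (dot m v u)\<^sup>2" using that by (simp add: mult_left_le_one_le)
      then show ?thesis using bound[of u] unfolding dot_mv_add_rank_one by linarith
    qed
  qed (use eps in simp)
  have psdA: "psd m (A t)" if "0 \<le> t" "t \<le> 1" for t
    unfolding psd_def
  proof (intro conjI allI sym)
    fix u have "0 \<le> a * dot m u u" using a by simp
    then show "0 \<le> dot m u (mv m (A t) u)" using ge[OF that, of u] by linarith
  qed
  define f where "f t = tr_pow m (A t) (Suc (2 * p))" for t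
  define h where "h t = dot m v (mpow m (A t) (2 * p) v)" for t
  define h' where "h' t = - \<epsilon> * (\<Sum>i<2*p. dot m v (mpow m (A t) (2 * p - 1 - i) v)
      * dot m v (mpow m (A t) i v))" for t
  note D = has_real_derivative_mpow_rank_one[where m = m and B = "shifted \<epsilon> S" and \<epsilon> = \<epsilon> and v = v, folded A_def]
  have f: "(f has_real_derivative (- \<theta> * h t)) (at t)" for t
  proof -
    have "(f has_real_derivative (\<Sum>q<m. - \<epsilon> * (\<Sum>i<Suc (2*p). dot m v (mpow m (A t)
        (Suc (2*p) - 1 - i) (std_vec q)) * mpow m (A t) i v q))) (at t)"
      unfolding f_def tr_pow_def
      by (subst sum.cong[OF refl dot_std_vec_left], simp)
         (intro DERIV_sum D)
    also have "(\<Sum>q<m. - \<epsilon> * (\<Sum>i<Suc (2*p). dot m v (mpow m (A t)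
        (Suc (2*p) - 1 - i) (std_vec q)) * mpow m (A t) i v q)) =
       - \<epsilon> * (\<Sum>i<Suc (2*p). \<Sum>q<m. dot m v (mpow m (A t)
        (Suc (2*p) - 1 - i) (std_vec q)) * mpow m (A t) i v q)"
      by (subst sum.swap) (simp only: sum_distrib_left)
    also have "\<dots> = - \<epsilon> * (\<Sum>i<Suc (2*p). dot m v (mpow m (A t) (2 * p) v))"
      by (intro arg_cong[of _ _ "\<lambda>x. - \<epsilon> * x"] sum.cong refl)
         (simp add: sum_dot_mpow_std_vec[OF sym])
    also have "\<dots> = - \<theta> * h t" by (simp add: \<theta>_def h_def)
    finally show ?thesis .
  qed
  have h: "(h has_real_derivative h' t) (at t)" for t
  proof -
    have "(h has_real_derivative (\<Sum>j<m. v j * (- \<epsilon> * (\<Sum>i<2*p. dot m v (mpow m (A t)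
        (2*p - 1 - i) v) * mpow m (A t) i v j)))) (at t)"
      unfolding h_def dot_def[of m v "mpow m _ (2 * p) v"]
      by (intro DERIV_sum DERIV_cmult D)
    also have "(\<Sum>j<m. v j * (- \<epsilon> * (\<Sum>i<2*p. dot m v (mpow m (A t)
        (2*p - 1 - i) v) * mpow m (A t) i v j))) = h' t"
      unfolding h'_def dot_def[of m v "mpow m (A t) i v" for i] sum_distrib_left
      by (subst sum.swap) (simp only: ac_simps)
    finally show ?thesis .
  qed
  have hpos: "h t \<ge> 0" if "0 \<le> t" "t \<le> 1" for t
    unfolding h_def by (rule psd_moment_nonneg[OF psdA[OF that]])
  \<comment> \<open>The derivative sums \<open>2 p\<close> products of two moments whose orders add
    up to \<open>2 p - 1\<close>. Each product is at most \<open>|v|^2\<close> times the moment of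
    order \<open>2 p - 1\<close>, and raising that order to \<open>2 p\<close> costs a factor
    \<open>1 / a\<close>.\<close>
  have h'_ge: "- (\<theta> / a * dot m v v) * h t \<le> h' t" if t: "0 \<le> t" "t \<le> 1" for t
  proof -
    have "(\<Sum>i<2*p. dot m v (mpow m (A t) (2 * p - 1 - i) v) * dot m v (mpow m (A t) i v))
        \<le> (\<Sum>i<2*p. dot m v v * (h t / a))"
    proof (rule sum_mono)
      fix i assume i: "i \<in> {..<2*p}"
      have "dot m v (mpow m (A t) (2 * p - 1 - i) v) * dot m v (mpow m (A t) i v)
          \<le> dot m v v * dot m v (mpow m (A t) (2 * p - 1 - i + i) v)"
        by (rule psd_moment_mult_le[OF psdA[OF t]])
      also have "2 * p - 1 - i + i = 2 * p - 1" using i by simp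
      also have "dot m v (mpow m (A t) (2 * p - 1) v) \<le> h t / a"
      proof -
        have "Suc (2 * p - 1) = 2 * p" using i by simp
        then have "a * dot m v (mpow m (A t) (2 * p - 1) v) \<le> h t"
          using psd_moment_Suc_ge[OF psdA[OF t] ge[OF t], of v "2 * p - 1"] by (simp only: h_def)
        then show ?thesis using a by (simp only: pos_le_divide_eq mult.commute)
      qed
      finally show "dot m v (mpow m (A t) (2 * p - 1 - i) v) * dot m v (mpow m (A t) i v)
          \<le> dot m v v * (h t / a)" by (simp add: mult_left_mono)
    qed
    also have "\<dots> = real (2 * p) * (dot m v v * (h t / a))" by simp
    also have "\<dots> \<le> real (Suc (2 * p)) * (dot m v v * (h t / a))"
      using hpos[OF t] a by (intro mult_right_mono) auto
    finally have "\<epsilon> * (\<Sum>i<2*p. dot m v (mpow m (A t) (2 * p - 1 - i) v) * dot m v (mpow m (A t) i v))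
       \<le> \<epsilon> * (real (Suc (2 * p)) * (dot m v v * (h t / a)))"
      using eps by (intro mult_left_mono) auto
    then show ?thesis by (simp add: h'_def \<theta>_def algebra_simps)
  qed
  show ?thesis
  \<comment> \<open>The decay estimate divides by the squared norm. If \<open>v\<close> vanishes,
    the moment at \<open>t = 0\<close> is 0 and it suffices that \<open>f\<close> is
    nonincreasing.\<close>
  proof (cases "dot m v v = 0")
    case True
    then have "v j = 0" if "j < m" for j
      using that by (auto simp: dot_def sum_nonneg_eq_0_iff)
    then have h0: "dot m v u = 0" for u by (simp add: dot_def)
    have "f 1 \<le> f 0"
      by (rule DERIV_nonpos_imp_nonincreasing)
        (auto intro!: exI[of _ "- \<theta> * h _"] f simp: hpos theta less_imp_le mult_le_0_iff)
    then show ?thesis by (simp add: f_def A0 A1 h0)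
  next
    case False
    then have pos: "0 < dot m v v" using dot_self_nonneg[of m v] by linarith
    have "f 1 \<le> f 0 - \<theta> / (\<theta> / a) * ((1 - exp (- (\<theta> / a) * dot m v v)) / dot m v v) * h 0"
      by (rule rank_one_decay[OF f h h'_ge]) (use pos a theta in auto)
    also have "\<theta> / (\<theta> / a) = a" using theta by simp
    finally have "f 1 \<le> f 0 - a * ((1 - exp (- (\<theta> / a) * dot m v v)) / dot m v v) * h 0" .
    moreover have "a * ((1 - exp (- (\<theta> / a) * R)) / R) * h 0
        \<le> a * ((1 - exp (- (\<theta> / a) * dot m v v)) / dot m v v) * h 0"
      using a hpos[of 0] by (intro mult_right_mono mult_left_mono one_minus_exp_div_antimono pos R) auto
    ultimately show ?thesis by (simp add: f_def h_def A0 A1)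
  qed
qed

section \<open>Trace inequalities for powers\<close>

text \<open>At a basis vector \<open>e\<close> the even power gives the squared norm of
  \<open>A^p e\<close> and the odd power the form of \<open>A\<close> at \<open>A^p e\<close>, so a
  bound on the form compares the traces entry by entry.\<close>

lemma tr_pow_odd_le_even:
  assumes "symm m A" and le: "\<And>u. dot m u (mv m A u) \<le> dot m u u"
  shows "tr_pow m A (Suc (2 * p)) \<le> tr_pow m A (2 * p)"
  unfolding tr_pow_def
proof (rule sum_mono)
  fix q
  show "dot m (std_vec q) (mpow m A (Suc (2 * p)) (std_vec q)) \<le> dot m (std_vec q) (mpow m A (2 * p) (std_vec q))"
    using le[of "mpow m A p (std_vec q)"] dot_mpow[OF assms(1), of p "std_vec q" p "std_vec q"]
      dot_mpow[OF assms(1), of p "std_vec q" "Suc p" "std_vec q"]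
    by (simp add: mult_2)
qed

lemma tr_pow_odd_ge_even:
  assumes "symm m A" and ge: "\<And>u. a * dot m u u \<le> dot m u (mv m A u)"
  shows "a * tr_pow m A (2 * p) \<le> tr_pow m A (Suc (2 * p))"
  unfolding tr_pow_def sum_distrib_left
proof (rule sum_mono)
  fix q
  show "a * dot m (std_vec q) (mpow m A (2 * p) (std_vec q)) \<le> dot m (std_vec q) (mpow m A (Suc (2 * p)) (std_vec q))"
    using ge[of "mpow m A p (std_vec q)"] dot_mpow[OF assms(1), of p "std_vec q" p "std_vec q"]
      dot_mpow[OF assms(1), of p "std_vec q" "Suc p" "std_vec q"]
    by (simp add: mult_2)
qed

text \<open>The trace of \<open>A^(2 p)\<close> is the squared Hilbert-Schmidt norm of
  \<open>A^p\<close>, which dominates the squared operator norm.\<close>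

lemma dot_mpow_self_le_tr_pow:
  assumes "symm m A"
  shows "dot m (mpow m A p u) (mpow m A p u) \<le> dot m u u * tr_pow m A (2 * p)"
proof -
  have "dot m (mpow m A p u) (mpow m A p u) = (\<Sum>q<m. (dot m (mpow m A p (std_vec q)) u)\<^sup>2)"
    unfolding dot_def[of m "mpow m A p u"]
  proof (intro sum.cong refl)
    fix q assume q: "q \<in> {..<m}"
    have "mpow m A p u q = dot m (mpow m A p (std_vec q)) u"
      using dot_mpow[OF assms, of p "std_vec q" 0 u] q by (simp add: dot_std_vec_left)
    then show "mpow m A p u q * mpow m A p u q = (dot m (mpow m A p (std_vec q)) u)\<^sup>2"
      by (simp add: power2_eq_square)
  qed
  also have "\<dots> \<le> (\<Sum>q<m. dot m u u * dot m (std_vec q) (mpow m A (2 * p) (std_vec q)))"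
    using dot_Cauchy_Schwarz[of m "mpow m A p (std_vec q)" u for q]
    by (intro sum_mono) (simp add: dot_mpow[OF assms] mult_2 mult.commute[of "dot m u u"])
  finally show ?thesis by (simp add: tr_pow_def sum_distrib_left)
qed

lemma mpow_eigenvector:
  assumes "\<And>j. j < m \<Longrightarrow> mv m A u j = \<mu> * u j" "j < m"
  shows "mpow m A p u j = \<mu> ^ p * u j"
  using \<open>j < m\<close>
proof (induction p arbitrary: j)
  case (Suc p)
  have "mpow m A (Suc p) u j = mv m A (\<lambda>j. \<mu> ^ p * u j) j"
    unfolding mpow_Suc by (intro fun_cong[OF mv_cong] Suc.IH)
  then show ?case using assms(1)[OF Suc.prems] by (simp add: mv_scale)
qed simp

text \<open>A small eigenvalue of \<open>S\<close> makes the trace of a high power of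
  \<open>1 - \<epsilon> S\<close> large: apply the Hilbert-Schmidt bound to the eigenvector, then
  pass to the odd exponent at the cost of \<open>a\<close>.\<close>

lemma tr_pow_shifted_ge_eigenvalue:
  assumes "symm m S" and bound: "\<And>u. dot m u (mv m S u) \<le> L * dot m u u"
    and a: "0 < a" "\<epsilon> * L \<le> 1 - a" and eps: "0 \<le> \<epsilon>"
    and eig: "\<And>j. j < m \<Longrightarrow> mv m S u j = \<mu> * u j" and u: "dot m u u > 0"
  shows "a * (1 - \<epsilon> * \<mu>) ^ (2 * p) \<le> tr_pow m (shifted \<epsilon> S) (Suc (2 * p))"
proof -
  let ?A = "shifted \<epsilon> S"
  have sym: "symm m ?A" using assms(1) by (rule symm_shifted)
  have ge: "a * dot m u u \<le> dot m u (mv m ?A u)" for u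
    by (rule dot_mv_shifted_ge[OF bound a(2) eps])
  have "mv m ?A u j = (1 - \<epsilon> * \<mu>) * u j" if "j < m" for j
    using that by (simp add: mv_shifted eig algebra_simps)
  then have "dot m (mpow m ?A p u) (mpow m ?A p u)
      = dot m (\<lambda>j. (1 - \<epsilon> * \<mu>) ^ p * u j) (\<lambda>j. (1 - \<epsilon> * \<mu>) ^ p * u j)"
    by (intro dot_cong) (simp_all add: mpow_eigenvector)
  also have "\<dots> = (1 - \<epsilon> * \<mu>) ^ (2 * p) * dot m u u"
    by (simp only: dot_scale_left dot_scale_right) (simp add: mult_2 power_add)
  finally have "(1 - \<epsilon> * \<mu>) ^ (2 * p) * dot m u u \<le> tr_pow m ?A (2 * p) * dot m u u"
    using dot_mpow_self_le_tr_pow[OF sym, of p u] by (simp add: mult.commute[of _ "dot m u u"])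
  then have "(1 - \<epsilon> * \<mu>) ^ (2 * p) \<le> tr_pow m ?A (2 * p)" using u by simp
  then have "a * (1 - \<epsilon> * \<mu>) ^ (2 * p) \<le> a * tr_pow m ?A (2 * p)" using a by simp
  also have "\<dots> \<le> tr_pow m ?A (Suc (2 * p))" by (rule tr_pow_odd_ge_even[OF sym ge])
  finally show ?thesis .
qed

section \<open>The smallest eigenvalue\<close>

text \<open>\<open>lambda_min\<close> is a \<open>Min\<close>, which is meaningful only on a finite
  nonempty set. Eigenvectors cut off at \<open>m\<close> are eigenvectors of a genuine
  \<open>m\<close> by \<open>m\<close> matrix, whose spectrum is finite.\<close>

lemma finite_eigenvalues_mat: "finite (eigenvalues_mat m A)"
proof -
  define M where "M = Matrix.mat m m (\<lambda>(i, j). A i j)"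
  have M: "M \<in> carrier_mat m m" by (simp add: M_def)
  have "eigenvalues_mat m A \<subseteq> spectrum M"
  proof
    fix l assume "l \<in> eigenvalues_mat m A"
    then obtain c where c: "\<exists>j<m. c j \<noteq> 0" "\<And>j. j < m \<Longrightarrow> (\<Sum>k<m. A j k * c k) = l * c j"
      by (auto simp: eigenvalues_mat_def)
    have "eigenvector M (Matrix.vec m c) l"
      unfolding eigenvector_def
    proof (intro conjI)
      show "Matrix.vec m c \<noteq> 0\<^sub>v (dim_row M)"
      proof
        assume eq: "Matrix.vec m c = 0\<^sub>v (dim_row M)"
        have "c j = 0" if "j < m" for j
          using arg_cong[OF eq, of "\<lambda>v. v $ j"] that by (simp add: M_def)
        then show False using c(1) by auto
      qed
      show "M *\<^sub>v Matrix.vec m c = l \<cdot>\<^sub>v Matrix.vec m c"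
        by (rule eq_vecI) (auto simp: M_def scalar_prod_def c(2) atLeast0LessThan)
    qed (simp add: M_def)
    then show "l \<in> spectrum M" by (auto simp: spectrum_def eigenvalue_def)
  qed
  then show ?thesis using card_finite_spectrum(1)[OF M] by (rule finite_subset)
qed

text \<open>Coercivity leaves only the zero vector in the kernel, so the determinant is nonzero and
  a right inverse exists. This solves the normal equations later.\<close>

lemma coercive_solvable:
  assumes "\<gamma> > 0" and ge: "\<And>u. \<gamma> * dot m u u \<le> dot m u (mv m A u)"
  shows "\<exists>c. \<forall>j<m. mv m A c j = b j"
proof -
  define M where "M = Matrix.mat m m (\<lambda>(i, j). A i j)"
  have M: "M \<in> carrier_mat m m" by (simp add: M_def)
  have nth: "(M *\<^sub>v v) $ j = mv m A (($) v) j" if "v \<in> carrier_vec m" "j < m" for v j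
    using that by (simp add: M_def scalar_prod_def mv_def atLeast0LessThan)
  have "Determinant.det M \<noteq> 0"
  proof
    assume "Determinant.det M = 0"
    then obtain v where v: "v \<in> carrier_vec m" "v \<noteq> 0\<^sub>v m" "M *\<^sub>v v = 0\<^sub>v m"
      using det_0_iff_vec_prod_zero_field[OF M] by auto
    have "mv m A (($) v) j = 0" if "j < m" for j
      using nth[OF v(1) that] v(3) that by simp
    then have "dot m (($) v) (mv m A (($) v)) = 0" by (simp add: dot_def)
    then have "\<gamma> * dot m (($) v) (($) v) \<le> 0" using ge[of "($) v"] by simp
    then have "dot m (($) v) (($) v) = 0"
      using \<open>\<gamma> > 0\<close> dot_self_nonneg[of m "($) v"] by (simp add: mult_le_0_iff)
    then have "v $ j = 0" if "j < m" for j
      using that by (auto simp: dot_def sum_nonneg_eq_0_iff)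
    then have "v = 0\<^sub>v m" using v(1) by (intro eq_vecI) auto
    then show False using v(2) by simp
  qed
  then have "M \<in> Units (ring_mat TYPE(real) m ())" by (rule det_non_zero_imp_unit[OF M])
  then have "\<exists>B\<in>carrier_mat m m. B * M = 1\<^sub>m m \<and> M * B = 1\<^sub>m m"
    by (simp add: Units_def ring_mat_def)
  then obtain B where B: "B \<in> carrier_mat m m" "M * B = 1\<^sub>m m" by blast
  define c where "c = B *\<^sub>v Matrix.vec m b"
  have c: "c \<in> carrier_vec m" unfolding c_def by (rule mult_mat_vec_carrier[OF B(1)]) simp
  have "M *\<^sub>v c = (M * B) *\<^sub>v Matrix.vec m b"
    unfolding c_def by (rule assoc_mult_mat_vec[OF M B(1), symmetric]) simp
  then have "M *\<^sub>v c = Matrix.vec m b" by (simp add: B(2))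
  then have "mv m A (($) c) j = b j" if "j < m" for j
    using nth[OF c that] that by simp
  then show ?thesis by blast
qed

text \<open>Let \<open>l\<close> be the minimum of the Rayleigh quotient over the unit sphere. Then
  \<open>A - l\<close> is positive semidefinite and its form vanishes at the minimiser, which is
  therefore an eigenvector.\<close>

lemma ex_eigenvalue_le_quadratic_form:
  assumes m: "m \<ge> 1" and sym: "symm m A"
  shows "\<exists>l\<in>eigenvalues_mat m A. \<forall>u. l * dot m u u \<le> dot m u (mv m A u)"
proof -
  \<comment> \<open>Coordinates from \<open>m\<close> on are fixed to 0, so that the sphere is a
    closed subset of a product of compact sets.\<close>
  define K where "K = PiE UNIV (\<lambda>j. if j < m then {-1..1::real} else {0}) \<inter> {u. dot m u u = 1}"
  have coord: "continuous_on X (\<lambda>u. u j :: real)" for X and j :: nat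
    by (rule continuous_on_subset[OF continuous_on_product_coordinates]) simp
  have "compactin (product_topology (\<lambda>_. euclidean) UNIV) (PiE UNIV (\<lambda>j::nat. if j < m then {-1..1::real} else {0}))"
    unfolding compactin_PiE by auto
  then have "compact (PiE UNIV (\<lambda>j::nat. if j < m then {-1..1::real} else {0}))"
    by (simp add: euclidean_product_topology)
  moreover have "closed {u. dot m u u = 1}"
    unfolding dot_def by (intro closed_Collect_eq continuous_intros coord)
  ultimately have K: "compact K" unfolding K_def by blast
  have K_mem: "\<exists>w\<in>K. dot m w (mv m A w) = dot m u (mv m A u) / dot m u u"
    if pos: "dot m u u > 0" for u
  proof -
    define s where "s = 1 / sqrt (dot m u u)"
    have s: "s * (s * x) = x / dot m u u" for x using pos by (simp add: s_def)
    define w where "w j = (if j < m then s * u j else 0)" for j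
    have w_in: "w j = s * u j" if "j < m" for j using that by (simp add: w_def)
    have w_out: "w j = 0" if "\<not> j < m" for j using that by (simp add: w_def)
    have "dot m w w = dot m (\<lambda>j. s * u j) (\<lambda>j. s * u j)" by (intro dot_cong w_in)
    also have "\<dots> = 1" using pos by (simp only: dot_scale_left dot_scale_right s) simp
    finally have one: "dot m w w = 1" .
    have le: "w j \<in> {-1..1}" if "j < m" for j
    proof -
      have "(w j)\<^sup>2 \<le> dot m w w" unfolding dot_def power2_eq_square
        using that by (intro member_le_sum) auto
      then have "\<bar>w j\<bar> \<le> 1" unfolding one by (simp only: abs_square_le_1)
      then show ?thesis by auto
    qed
    have "w j \<in> (if j < m then {-1..1} else {0})" for j
      using le[of j] w_out[of j] by (cases "j < m") simp_all
    then have "w \<in> PiE UNIV (\<lambda>j. if j < m then {-1..1} else {0})" by (intro PiE_I) simp_all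
    then have "w \<in> K" unfolding K_def using one by blast
    moreover have "mv m A w = mv m A (\<lambda>j. s * u j)" by (intro mv_cong w_in)
    then have "dot m w (mv m A w) = dot m (\<lambda>j. s * u j) (mv m A (\<lambda>j. s * u j))"
      by (intro dot_cong) (simp_all add: w_in)
    then have "dot m w (mv m A w) = dot m u (mv m A u) / dot m u u"
      unfolding mv_scale dot_scale_left dot_scale_right s .
    ultimately show ?thesis by blast
  qed
  have "dot m (std_vec 0) (std_vec 0) > 0"
    by (subst dot_std_vec_left) (use m in \<open>simp_all add: std_vec_def\<close>)
  from K_mem[OF this] have "K \<noteq> {}" by auto
  moreover have "continuous_on K (\<lambda>u. dot m u (mv m A u))"
    unfolding dot_def mv_def by (intro continuous_intros coord)
  ultimately obtain u where u: "u \<in> K" "\<And>v. v \<in> K \<Longrightarrow> dot m u (mv m A u) \<le> dot m v (mv m A v)"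
    using continuous_attains_inf[OF K] by blast
  define l where "l = dot m u (mv m A u)"
  have uu: "dot m u u = 1" using u(1) by (simp add: K_def)
  have ge: "l * dot m v v \<le> dot m v (mv m A v)" for v
  proof (cases "dot m v v = 0")
    case True
    then have "v j = 0" if "j < m" for j
      using that by (auto simp: dot_def sum_nonneg_eq_0_iff)
    then have "dot m v w = 0" for w by (simp add: dot_def)
    then show ?thesis using True by simp
  next
    case False
    then have pos: "0 < dot m v v" using dot_self_nonneg[of m v] by linarith
    obtain w where "w \<in> K" "dot m w (mv m A w) = dot m v (mv m A v) / dot m v v"
      using K_mem[OF pos] by blast
    then have "l \<le> dot m v (mv m A v) / dot m v v" using u(2) unfolding l_def by metis
    then show ?thesis using pos by (simp add: field_simps)
  qed
  let ?B = "\<lambda>j k. A j k - (if j = k then l else 0)"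
  have mvB: "mv m ?B v j = mv m A v j - l * v j" if "j < m" for v j
    using that by (simp add: mv_def left_diff_distrib sum_subtractf
        if_distrib[of "\<lambda>c. c * _"] cong: if_cong)
  have dotB: "dot m w (mv m ?B v) = dot m w (mv m A v) - l * dot m w v" for v w
  proof -
    have "dot m w (mv m ?B v) = dot m w (\<lambda>j. mv m A v j + (- l) * v j)"
      by (intro dot_cong) (simp_all add: mvB)
    then show ?thesis unfolding dot_add_right dot_scale_right by simp
  qed
  have "psd m ?B"
    unfolding psd_def
  proof (intro conjI allI)
    show "symm m ?B" using sym by (simp add: symm_def)
    show "0 \<le> dot m v (mv m ?B v)" for v using ge[of v] by (simp add: dotB)
  qed
  \<comment> \<open>On the right stands the factor \<open>u \<bullet> ?B u = 0\<close>; on the left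
    stands the square of \<open>|?B u|^2\<close>.\<close>
  from psd_Cauchy_Schwarz[OF this, of "mv m ?B u" u]
  have "dot m (mv m ?B u) (mv m ?B u) = 0" using uu by (simp add: dotB[of u u] l_def)
  then have "mv m ?B u j = 0" if "j < m" for j
    using that by (auto simp: dot_def sum_nonneg_eq_0_iff)
  then have "(\<Sum>k<m. A j k * u k) = l * u j" if "j < m" for j
    using that mvB[of j u] by (simp add: mv_def)
  moreover have "\<exists>j<m. u j \<noteq> 0"
  proof (rule ccontr)
    assume "\<not> ?thesis"
    then have "dot m u u = 0" by (simp add: dot_def)
    then show False using uu by simp
  qed
  ultimately have "l \<in> eigenvalues_mat m A" by (auto simp: eigenvalues_mat_def)
  then show ?thesis using ge by blast
qed

lemma lambda_min_in_eigenvalues: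
  assumes "m \<ge> 1" "symm m A"
  shows "lambda_min m A \<in> eigenvalues_mat m A"
  unfolding lambda_min_def
  using ex_eigenvalue_le_quadratic_form[OF assms] by (intro Min_in finite_eigenvalues_mat) auto

lemma eigenvalues_matE:
  assumes "l \<in> eigenvalues_mat m A"
  obtains u where "dot m u u > 0" "\<And>j. j < m \<Longrightarrow> mv m A u j = l * u j"
proof -
  obtain c j where c: "j < m" "c j \<noteq> 0" "\<And>j. j < m \<Longrightarrow> (\<Sum>k<m. A j k * c k) = l * c j"
    using assms by (auto simp: eigenvalues_mat_def)
  have "0 < c j * c j" using c(2) by (simp add: zero_less_mult_iff) linarith
  also have "\<dots> \<le> dot m c c" unfolding dot_def using c(1) by (intro member_le_sum) auto
  finally show ?thesis using that[of c] c(3) by (simp add: mv_def)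
qed

text \<open>Forward, the eigenvalue bounding the form from below is at least the minimum; backward,
  the form is tested at an eigenvector for the minimum.\<close>

lemma lambda_min_ge_iff:
  assumes "m \<ge> 1" "symm m A"
  shows "r \<le> lambda_min m A \<longleftrightarrow> (\<forall>u. r * dot m u u \<le> dot m u (mv m A u))"
proof
  obtain l where l: "l \<in> eigenvalues_mat m A" "\<And>u. l * dot m u u \<le> dot m u (mv m A u)"
    using ex_eigenvalue_le_quadratic_form[OF assms] by blast
  assume "r \<le> lambda_min m A"
  also have "\<dots> \<le> l" unfolding lambda_min_def by (intro Min_le finite_eigenvalues_mat l)
  finally have "r * dot m u u \<le> l * dot m u u" for u by (intro mult_right_mono) auto
  then show "\<forall>u. r * dot m u u \<le> dot m u (mv m A u)" using l(2) order_trans by blast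
next
  assume ge: "\<forall>u. r * dot m u u \<le> dot m u (mv m A u)"
  obtain u where u: "dot m u u > 0" "\<And>j. j < m \<Longrightarrow> mv m A u j = lambda_min m A * u j"
    using eigenvalues_matE[OF lambda_min_in_eigenvalues[OF assms]] by blast
  have "dot m u (mv m A u) = dot m u (\<lambda>j. lambda_min m A * u j)"
    by (intro dot_cong) (simp_all add: u(2))
  then have "r * dot m u u \<le> lambda_min m A * dot m u u"
    using ge[rule_format, of u] by (simp only: dot_scale_right)
  then show "r \<le> lambda_min m A" using u(1) by simp
qed

text \<open>Only countably many vectors need to be tested, which makes the event measurable.\<close>

lemma quadratic_form_ge_iff_rational:
  "(\<forall>u. r * dot m u u \<le> dot m u (mv m A u)) \<longleftrightarrow>
   (\<forall>q :: rat list. r * dot m (\<lambda>j. of_rat (q ! j)) (\<lambda>j. of_rat (q ! j))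
       \<le> dot m (\<lambda>j. of_rat (q ! j)) (mv m A (\<lambda>j. of_rat (q ! j))))" (is "?L \<longleftrightarrow> ?R")
proof
  assume R: ?R
  show ?L
  proof
    fix u
    have "\<exists>q. \<forall>n::nat. \<bar>real_of_rat (q n) - u j\<bar> < 1 / real (Suc n)" for j :: nat
    proof -
      have "\<exists>q. \<bar>real_of_rat q - u j\<bar> < 1 / real (Suc n)" for n
      proof -
        have "u j < u j + 1 / real (Suc n)" by simp
        from of_rat_dense[OF this] obtain q
          where "u j < real_of_rat q" "real_of_rat q < u j + 1 / real (Suc n)" by blast
        then have "\<bar>real_of_rat q - u j\<bar> < 1 / real (Suc n)" by linarith
        then show ?thesis by blast
      qed
      then show ?thesis by (rule choice[OF allI])
    qed
    then have "\<forall>j. \<exists>q. \<forall>n::nat. \<bar>real_of_rat (q n) - u j\<bar> < 1 / real (Suc n)" by blast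
    from choice[OF this] obtain q where q: "\<And>(j::nat) n. \<bar>real_of_rat (q j n) - u j\<bar> < 1 / real (Suc n)" by blast
    have lim: "(\<lambda>n. real_of_rat (q j n)) \<longlonglongrightarrow> u j" for j
    proof (rule LIM_zero_cancel, rule Lim_null_comparison)
      show "\<forall>\<^sub>F n in sequentially. norm (real_of_rat (q j n) - u j) \<le> 1 / real (Suc n)"
        using q by (simp add: less_imp_le)
      show "(\<lambda>n. 1 / real (Suc n)) \<longlonglongrightarrow> 0" by (rule lim_1_over_n[THEN LIMSEQ_Suc])
    qed
    define U where "U n j = real_of_rat (q j n)" for n j :: nat
    have "r * dot m (U n) (U n) \<le> dot m (U n) (mv m A (U n))" for n
    proof -
      \<comment> \<open>A list of length \<open>m\<close> is enough, because both forms read only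
        entries below \<open>m\<close>.\<close>
      let ?q = "map (\<lambda>j. q j n) [0..<m]"
      have U: "real_of_rat (?q ! j) = U n j" if "j < m" for j using that by (simp add: U_def)
      have "mv m A (\<lambda>j. real_of_rat (?q ! j)) = mv m A (U n)" by (rule mv_cong) (rule U)
      moreover have "dot m (\<lambda>j. real_of_rat (?q ! j)) (\<lambda>j. real_of_rat (?q ! j)) = dot m (U n) (U n)"
        by (intro dot_cong U)
      moreover have "dot m (\<lambda>j. real_of_rat (?q ! j)) (mv m A (U n)) = dot m (U n) (mv m A (U n))"
        by (intro dot_cong U refl)
      ultimately show ?thesis using R[rule_format, of ?q] by (simp only:)
    qed
    then have le: "\<exists>N. \<forall>n\<ge>N. r * dot m (U n) (U n) \<le> dot m (U n) (mv m A (U n))" by blast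
    have "(\<lambda>n. r * dot m (U n) (U n)) \<longlonglongrightarrow> r * dot m u u"
      unfolding dot_def U_def by (intro tendsto_intros lim)
    moreover have "(\<lambda>n. dot m (U n) (mv m A (U n))) \<longlonglongrightarrow> dot m u (mv m A u)"
      unfolding dot_def mv_def U_def by (intro tendsto_intros lim)
    ultimately show "r * dot m u u \<le> dot m u (mv m A u)"
      using le by (rule LIMSEQ_le)
  qed
next
  assume L: ?L
  show ?R by (rule allI) (rule L[rule_format])
qed

section \<open>Matrix Chernoff bound for bounded isotropic vectors\<close>

lemma one_minus_divide_power_tendsto_exp:
  "(\<lambda>p. (1 - x / real (Suc (2 * p))) ^ (2 * p)) \<longlonglongrightarrow> exp (- x :: real)"
  by real_asymp

lemma tr_pow_nonneg: "psd m A \<Longrightarrow> 0 \<le> tr_pow m A k"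
  unfolding tr_pow_def by (intro sum_nonneg psd_moment_nonneg)

text \<open>The coefficients of \<open>v\<close> are separated from the matrix, so that the
  expectation over a random \<open>v\<close> can be taken with the matrix fixed.\<close>

lemma mpow_expand:
  assumes "j < m"
  shows "mpow m A q v j = (\<Sum>k<m. v k * mpow m A q (std_vec k) j)"
  using assms
proof (induction q arbitrary: j)
  case 0
  then show ?case by (simp add: std_vec_def if_distrib[of "\<lambda>c. _ * c"] cong: if_cong)
next
  case (Suc q)
  have "mpow m A (Suc q) v j = (\<Sum>i<m. A j i * (\<Sum>k<m. v k * mpow m A q (std_vec k) i))"
    unfolding mpow_Suc mv_def by (intro sum.cong refl) (simp add: Suc.IH)
  also have "\<dots> = (\<Sum>k<m. v k * mpow m A (Suc q) (std_vec k) j)"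
    unfolding mpow_Suc mv_def sum_distrib_left by (subst sum.swap) (simp only: ac_simps)
  finally show ?case .
qed

lemma mpow_identity: "j < m \<Longrightarrow> mpow m (\<lambda>j k. if j = k then 1 else 0) q u j = u j"
proof (induction q arbitrary: j)
  case (Suc q)
  then show ?case by (simp add: mv_def if_distrib[of "\<lambda>c. c * _"] cong: if_cong)
qed simp

lemma tr_pow_identity: "tr_pow m (\<lambda>j k. if j = k then 1 else 0) q = real m"
proof -
  have "tr_pow m (\<lambda>j k. if j = k then 1 else 0) q = (\<Sum>q<m. 1)"
    unfolding tr_pow_def
    by (intro sum.cong refl) (simp add: dot_std_vec_left mpow_identity, simp add: std_vec_def)
  then show ?thesis by simp
qed

lemma borel_measurable_mpow:
  assumes "\<And>j k. j < m \<Longrightarrow> k < m \<Longrightarrow> (\<lambda>x. A x j k) \<in> borel_measurable M'" "j < m"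
  shows "(\<lambda>x. mpow m (A x) q u j) \<in> borel_measurable M'"
  using assms(2)
proof (induction q arbitrary: j)
  case (Suc q)
  then show ?case unfolding mpow_Suc mv_def
    by (intro borel_measurable_sum borel_measurable_times assms(1)) auto
qed simp

lemma borel_measurable_tr_pow:
  assumes "\<And>j k. j < m \<Longrightarrow> k < m \<Longrightarrow> (\<lambda>x. A x j k) \<in> borel_measurable M'"
  shows "(\<lambda>x. tr_pow m (A x) q) \<in> borel_measurable M'"
  unfolding tr_pow_def dot_def
  by (intro borel_measurable_sum borel_measurable_times borel_measurable_mpow assms) auto

section \<open>Random Gram sums and the mean of their traces\<close>

text \<open>In the application \<open>N\<close> is the sampling measure, \<open>V j\<close> is
  \<open>\<phi> j / sqrt w\<close> and \<open>R\<close> is \<open>m / \<alpha>\<close>.\<close>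

locale bounded_isotropic = prob_space N for N :: "'a measure" +
  fixes V :: "nat \<Rightarrow> 'a \<Rightarrow> real" and m :: nat and R :: real
  assumes m_pos: "m \<ge> 1"
    and R_pos: "R > 0"
    and V_meas [measurable]: "\<And>j. j < m \<Longrightarrow> V j \<in> borel_measurable N"
    and V_orth: "\<And>j k. j < m \<Longrightarrow> k < m \<Longrightarrow> (\<integral>x. V j x * V k x \<partial>N) = (if j = k then 1 else 0)"
    and V_bounded: "\<And>x. dot m (\<lambda>j. V j x) (\<lambda>j. V j x) \<le> R"
begin

sublocale samples: product_prob_space "\<lambda>_::nat. N" "UNIV :: nat set"
  by unfold_locales

text \<open>Unnormalised and with the number of samples as a parameter, for an induction over
  samples; at \<open>l = n\<close> it is \<open>n\<close> times the Gram matrix.\<close>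

definition gsum :: "nat \<Rightarrow> (nat \<Rightarrow> 'a) \<Rightarrow> nat \<Rightarrow> nat \<Rightarrow> real" where
  "gsum l xs j k = (\<Sum>i<l. V j (xs i) * V k (xs i))"

lemma V_integrable: "j < m \<Longrightarrow> k < m \<Longrightarrow> integrable N (\<lambda>x. V j x * V k x)"
proof (rule integrable_const_bound[of _ R], rule AE_I2)
  fix x assume jk: "j < m" "k < m"
  have le: "(V i x)\<^sup>2 \<le> R" if "i < m" for i
  proof -
    have "V i x * V i x \<le> dot m (\<lambda>j. V j x) (\<lambda>j. V j x)"
      unfolding dot_def using that by (intro member_le_sum) auto
    then show ?thesis using V_bounded[of x] by (simp add: power2_eq_square)
  qed
  have "2 * \<bar>V j x * V k x\<bar> \<le> (V j x)\<^sup>2 + (V k x)\<^sup>2"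
    using sum_squares_bound[of "\<bar>V j x\<bar>" "\<bar>V k x\<bar>"] by (simp add: abs_mult)
  then show "norm (V j x * V k x) \<le> R" using le[OF jk(1)] le[OF jk(2)] by simp
qed measurable

lemma gsum_fun_upd: "gsum (Suc l) (xs(l := y)) = (\<lambda>j k. gsum l xs j k + V j y * V k y)"
  by (auto simp: gsum_def fun_eq_iff intro!: sum.cong)

lemma dot_mv_gsum: "dot m u (mv m (gsum l xs) u) = (\<Sum>i<l. (dot m (\<lambda>j. V j (xs i)) u)\<^sup>2)"
proof (induction l)
  case (Suc l)
  have "gsum (Suc l) xs = (\<lambda>j k. gsum l xs j k + 1 * (V j (xs l) * V k (xs l)))"
    by (simp add: gsum_def fun_eq_iff)
  then show ?case using dot_mv_add_rank_one[of m u "gsum l xs" 1 "\<lambda>j. V j (xs l)"] Suc by simp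
qed (simp add: gsum_def dot_def mv_def)

lemma symm_gsum: "symm m (gsum l xs)"
  by (simp add: symm_def gsum_def mult.commute)

lemma psd_gsum: "psd m (gsum l xs)"
  by (simp add: psd_def symm_gsum dot_mv_gsum sum_nonneg)

lemma V_dot_le: "(dot m (\<lambda>j. V j x) u)\<^sup>2 \<le> R * dot m u u"
  using dot_Cauchy_Schwarz[of m "\<lambda>j. V j x" u] mult_right_mono[OF V_bounded[of x], of "dot m u u"]
  by simp

lemma gsum_le: "dot m u (mv m (gsum l xs) u) \<le> real l * R * dot m u u"
  using sum_mono[of "{..<l}" "\<lambda>i. (dot m (\<lambda>j. V j (xs i)) u)\<^sup>2" "\<lambda>_. R * dot m u u"] V_dot_le
  by (simp add: dot_mv_gsum mult.assoc)

text \<open>Since \<open>V V^T\<close> has expectation 1, averaging \<open>V \<bullet> A^q V\<close>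
  gives the trace of \<open>A^q\<close>; the mean decrease of the trace is thus again expressed by a
  trace.\<close>

lemma integral_moment:
  shows "integrable N (\<lambda>x. dot m (\<lambda>j. V j x) (mpow m A q (\<lambda>j. V j x)))"
    and "(\<integral>x. dot m (\<lambda>j. V j x) (mpow m A q (\<lambda>j. V j x)) \<partial>N) = tr_pow m A q"
proof -
  have eq: "dot m (\<lambda>j. V j x) (mpow m A q (\<lambda>j. V j x))
      = (\<Sum>j<m. \<Sum>k<m. (V j x * V k x) * mpow m A q (std_vec k) j)" for x
    unfolding dot_def by (simp add: mpow_expand[of _ m A q "\<lambda>j. V j x"] sum_distrib_left mult.assoc)
  show "integrable N (\<lambda>x. dot m (\<lambda>j. V j x) (mpow m A q (\<lambda>j. V j x)))"
    unfolding eq by (intro Bochner_Integration.integrable_sum integrable_mult_left V_integrable) auto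
  have "(\<integral>x. dot m (\<lambda>j. V j x) (mpow m A q (\<lambda>j. V j x)) \<partial>N)
      = (\<Sum>j<m. \<Sum>k<m. (\<integral>x. V j x * V k x \<partial>N) * mpow m A q (std_vec k) j)"
    unfolding eq
    by (subst Bochner_Integration.integral_sum, (intro Bochner_Integration.integrable_sum integrable_mult_left V_integrable; simp),
        intro sum.cong refl)
       (subst Bochner_Integration.integral_sum, (intro Bochner_Integration.integrable_sum integrable_mult_left V_integrable; simp),
        intro sum.cong refl, simp)
  also have "\<dots> = (\<Sum>j<m. mpow m A q (std_vec j) j)"
    by (intro sum.cong refl) (simp add: V_orth if_distrib[of "\<lambda>c. c * _"] cong: if_cong)
  also have "\<dots> = tr_pow m A q" by (simp add: tr_pow_def dot_std_vec_left)
  finally show "(\<integral>x. dot m (\<lambda>j. V j x) (mpow m A q (\<lambda>j. V j x)) \<partial>N) = tr_pow m A q" .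
qed

text \<open>With \<open>A = 1 - \<epsilon> S\<close> and \<open>T\<close> the trace of its odd
  power, averaging the rank-one decrease gives at most \<open>T - c * tr (A^(2 p))\<close>. Because
  \<open>A \<le> 1\<close>, this is at most \<open>(1 - c) * T \<le> exp (- c) * T\<close>.\<close>

lemma nn_integral_tr_pow_step:
  fixes a \<epsilon> :: real and p :: nat
  defines "c \<equiv> a * ((1 - exp (- (\<epsilon> * real (Suc (2 * p)) / a) * R)) / R)"
  assumes S: "psd m S" and bound: "\<And>u. dot m u (mv m S u) \<le> L * dot m u u"
    and a: "0 < a" "\<epsilon> * (L + R) \<le> 1 - a" and eps: "0 < \<epsilon>"
  shows "(\<integral>\<^sup>+x. ennreal (tr_pow m (shifted \<epsilon> (\<lambda>j k. S j k + V j x * V k x)) (Suc (2 * p))) \<partial>N)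
     \<le> ennreal (exp (- c)) * ennreal (tr_pow m (shifted \<epsilon> S) (Suc (2 * p)))"
proof -
  let ?T = "tr_pow m (shifted \<epsilon> S) (Suc (2 * p))"
  let ?T' = "\<lambda>x. tr_pow m (shifted \<epsilon> (\<lambda>j k. S j k + V j x * V k x)) (Suc (2 * p))"
  let ?Q = "\<lambda>x. dot m (\<lambda>j. V j x) (mpow m (shifted \<epsilon> S) (2 * p) (\<lambda>j. V j x))"
  have c: "c \<ge> 0" unfolding c_def using a R_pos eps by (intro mult_nonneg_nonneg divide_nonneg_nonneg) auto
  have symS: "symm m S" using S by (simp add: psd_def)
  have bound': "dot m u (mv m S u) + (dot m (\<lambda>j. V j x) u)\<^sup>2 \<le> (L + R) * dot m u u" for x u
    using bound[of u] V_dot_le[of x u] by (simp add: algebra_simps)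
  have le: "?T' x \<le> ?T - c * ?Q x" for x
    unfolding c_def by (rule tr_pow_add_rank_one[OF S bound' a eps V_bounded])
  have psd': "psd m (shifted \<epsilon> (\<lambda>j k. S j k + V j x * V k x))" for x
    unfolding psd_def
  proof (intro conjI allI symm_shifted)
    show "symm m (\<lambda>j k. S j k + V j x * V k x)" using symS by (simp add: symm_def mult.commute)
    fix u
    have "a * dot m u u \<le> dot m u (mv m (shifted \<epsilon> (\<lambda>j k. S j k + V j x * V k x)) u)"
    proof (rule dot_mv_shifted_ge[OF _ a(2)])
      show "dot m u (mv m (\<lambda>j k. S j k + V j x * V k x) u) \<le> (L + R) * dot m u u" for u
        using bound'[of u x] dot_mv_add_rank_one[of m u S 1 "\<lambda>j. V j x"] by simp
    qed (use eps in simp)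
    then show "0 \<le> dot m u (mv m (shifted \<epsilon> (\<lambda>j k. S j k + V j x * V k x)) u)"
      using a by (meson dot_self_nonneg less_imp_le mult_nonneg_nonneg order_trans)
  qed
  have nonneg: "0 \<le> ?T' x" for x by (rule tr_pow_nonneg[OF psd'])
  have T: "0 \<le> ?T"
  proof -
    have "\<epsilon> * L \<le> \<epsilon> * (L + R)" using eps R_pos by (intro mult_left_mono) auto
    then have "\<epsilon> * L \<le> 1 - a" using a(2) by linarith
    from dot_mv_shifted_ge[OF bound this] have ge: "a * dot m u u \<le> dot m u (mv m (shifted \<epsilon> S) u)" for u
      using eps by simp
    have "0 \<le> dot m u (mv m (shifted \<epsilon> S) u)" for u
      using ge[of u] a by (meson dot_self_nonneg less_imp_le mult_nonneg_nonneg order_trans)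
    then show ?thesis by (intro tr_pow_nonneg) (simp add: psd_def symm_shifted[OF symS])
  qed
  have T_le: "?T \<le> tr_pow m (shifted \<epsilon> S) (2 * p)"
  proof (rule tr_pow_odd_le_even[OF symm_shifted[OF symS]])
    show "dot m u (mv m (shifted \<epsilon> S) u) \<le> dot m u u" for u
      using S eps by (simp add: dot_mv_shifted psd_def)
  qed
  \<comment> \<open>Nonnegativity, inherited from the trace below, allows the extended integral to
    be computed as a real one.\<close>
  have ge0: "0 \<le> ?T - c * ?Q x" for x using le[of x] nonneg[of x] by linarith
  have "(\<integral>\<^sup>+x. ennreal (?T' x) \<partial>N) \<le> (\<integral>\<^sup>+x. ennreal (?T - c * ?Q x) \<partial>N)"
    using le by (intro nn_integral_mono ennreal_leI)
  also have "\<dots> = ennreal (\<integral>x. ?T - c * ?Q x \<partial>N)"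
    by (intro nn_integral_eq_integral AE_I2 ge0 Bochner_Integration.integrable_diff integrable_const
        integrable_mult_right integral_moment)
  also have "(\<integral>x. ?T - c * ?Q x \<partial>N) = ?T - c * tr_pow m (shifted \<epsilon> S) (2 * p)"
    using integral_moment[of "shifted \<epsilon> S" "2 * p"] by (simp add: prob_space)
  also have "\<dots> \<le> (1 - c) * ?T" using mult_left_mono[OF T_le c] by (simp add: algebra_simps)
  also have "\<dots> \<le> exp (- c) * ?T" using exp_ge_add_one_self[of "- c"] T by (intro mult_right_mono) auto
  finally show ?thesis using T by (simp add: ennreal_mult ennreal_leI)
qed

lemma V_sample_measurable [measurable]:
  "j < m \<Longrightarrow> i \<in> I \<Longrightarrow> (\<lambda>xs. V j (xs i)) \<in> borel_measurable (PiM I (\<lambda>_. N))"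
  by (rule measurable_compose[where f = "\<lambda>xs. xs i" and g = "V j", OF _ V_meas]) simp_all

lemma gsum_measurable:
  assumes "{..<l} \<subseteq> I" "j < m" "k < m"
  shows "(\<lambda>xs. gsum l xs j k) \<in> borel_measurable (PiM I (\<lambda>_. N))"
  unfolding gsum_def using assms
  by (intro borel_measurable_sum borel_measurable_times V_sample_measurable) auto

lemma tr_pow_gsum_measurable:
  assumes "{..<l} \<subseteq> I"
  shows "(\<lambda>xs. tr_pow m (shifted \<epsilon> (gsum l xs)) q) \<in> borel_measurable (PiM I (\<lambda>_. N))"
  using gsum_measurable[OF assms]
  by (intro borel_measurable_tr_pow) (simp add: shifted_def)

text \<open>Fubini isolates the last sample, and each sample contributes a factor
  \<open>exp (- c)\<close>. Without samples the matrix is 1, of trace \<open>m\<close>.\<close>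

lemma nn_integral_tr_pow_le:
  fixes a \<epsilon> :: real and p :: nat
  defines "c \<equiv> a * ((1 - exp (- (\<epsilon> * real (Suc (2 * p)) / a) * R)) / R)"
  assumes a: "0 < a" "\<epsilon> * (real n * R) \<le> 1 - a" and eps: "0 < \<epsilon>" and "l \<le> n"
  shows "(\<integral>\<^sup>+xs. ennreal (tr_pow m (shifted \<epsilon> (gsum l xs)) (Suc (2 * p))) \<partial>PiM {..<l} (\<lambda>_. N))
     \<le> ennreal (exp (- c) ^ l * real m)"
  using \<open>l \<le> n\<close>
proof (induction l)
  case 0
  have "shifted \<epsilon> (gsum 0 xs) = (\<lambda>j k. if j = k then 1 else 0)" for xs
    by (simp add: shifted_def gsum_def)
  then show ?case
    by (simp add: tr_pow_identity PiM_empty nn_integral_count_space_finite)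
next
  case (Suc l)
  have ins: "{..<Suc l} = insert l {..<l}" by auto
  have "(\<integral>\<^sup>+xs. ennreal (tr_pow m (shifted \<epsilon> (gsum (Suc l) xs)) (Suc (2 * p))) \<partial>PiM {..<Suc l} (\<lambda>_. N))
      = (\<integral>\<^sup>+xs. (\<integral>\<^sup>+y. ennreal (tr_pow m (shifted \<epsilon> (gsum (Suc l) (xs(l := y)))) (Suc (2 * p))) \<partial>N)
          \<partial>PiM {..<l} (\<lambda>_. N))"
    unfolding ins
    by (rule samples.product_nn_integral_insert)
       (auto intro!: measurable_compose[OF _ measurable_ennreal] tr_pow_gsum_measurable)
  also have "\<dots> \<le> (\<integral>\<^sup>+xs. ennreal (exp (- c)) * ennreal (tr_pow m (shifted \<epsilon> (gsum l xs)) (Suc (2 * p)))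
          \<partial>PiM {..<l} (\<lambda>_. N))"
  proof (rule nn_integral_mono)
    fix xs
    \<comment> \<open>The condition on \<epsilon> for all \<open>n\<close> samples covers each
      earlier stage with its new sample included.\<close>
    have "(real l * R + R) \<le> real n * R"
      using Suc.prems R_pos mult_right_mono[of "real l + 1" "real n" R] by (simp add: algebra_simps)
    then have "\<epsilon> * (real l * R + R) \<le> 1 - a"
      using a(2) eps mult_left_mono[of "real l * R + R" "real n * R" \<epsilon>] by linarith
    then show "(\<integral>\<^sup>+y. ennreal (tr_pow m (shifted \<epsilon> (gsum (Suc l) (xs(l := y)))) (Suc (2 * p))) \<partial>N)
       \<le> ennreal (exp (- c)) * ennreal (tr_pow m (shifted \<epsilon> (gsum l xs)) (Suc (2 * p)))"
      unfolding gsum_fun_upd c_def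
      by (intro nn_integral_tr_pow_step[OF psd_gsum gsum_le a(1) _ eps])
  qed
  also have "\<dots> = ennreal (exp (- c)) *
      (\<integral>\<^sup>+xs. ennreal (tr_pow m (shifted \<epsilon> (gsum l xs)) (Suc (2 * p))) \<partial>PiM {..<l} (\<lambda>_. N))"
    by (intro nn_integral_cmult measurable_compose[OF _ measurable_ennreal] tr_pow_gsum_measurable) simp
  also have "\<dots> \<le> ennreal (exp (- c)) * ennreal (exp (- c) ^ l * real m)"
    using Suc by (intro mult_left_mono) auto
  also have "\<dots> = ennreal (exp (- c) ^ Suc l * real m)"
    by (simp add: mult.assoc flip: ennreal_mult')
  finally show ?case .
qed

section \<open>Lower tail of the smallest eigenvalue\<close>

lemma lambda_min_event_measurable:
  "{xs \<in> space (PiM {..<n} (\<lambda>_. N)). s \<le> lambda_min m (gsum n xs)} \<in> sets (PiM {..<n} (\<lambda>_. N))"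
proof -
  have m: "(\<lambda>xs. dot m u (mv m (gsum n xs) u)) \<in> borel_measurable (PiM {..<n} (\<lambda>_. N))" for u
    unfolding dot_def mv_def
    by (intro borel_measurable_sum borel_measurable_times gsum_measurable) auto
  show ?thesis
    unfolding lambda_min_ge_iff[OF m_pos symm_gsum] quadratic_form_ge_iff_rational
    using m by measurable
qed

text \<open>Markov's inequality for the trace: on the event it is at least
  \<open>a p * (1 - \<epsilon> p * s) ^ (2 * p)\<close>, while its mean is at most
  \<open>exp (- c p) ^ n * m\<close>. Letting \<open>p\<close> tend to infinity turns both sides
  into exponentials.\<close>

lemma prob_lambda_min_less:
  assumes "\<theta> > 0"
  shows "measure (PiM {..<n} (\<lambda>_. N)) {xs \<in> space (PiM {..<n} (\<lambda>_. N)). lambda_min m (gsum n xs) < s}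
    \<le> real m * exp (\<theta> * s - real n * ((1 - exp (- \<theta> * R)) / R))"
proof -
  let ?P = "PiM {..<n} (\<lambda>_. N)"
  let ?E = "{xs \<in> space ?P. lambda_min m (gsum n xs) < s}"
  interpret P: prob_space ?P by (intro prob_space_PiM prob_space_axioms)
  have "?E = space ?P - {xs \<in> space ?P. s \<le> lambda_min m (gsum n xs)}" by auto
  then have E: "?E \<in> sets ?P" using lambda_min_event_measurable by auto
  \<comment> \<open>The step times the exponent \<open>2 p + 1\<close> is the constant \<theta>;
    \<open>a p\<close> is the largest constant allowed by the spectral condition for
    \<open>n\<close> samples.\<close>
  define \<epsilon> where "\<epsilon> p = \<theta> / real (Suc (2 * p))" for p
  define a where "a p = 1 - \<epsilon> p * (real n * R)" for p
  have lim: "\<epsilon> \<longlonglongrightarrow> 0" unfolding \<epsilon>_def by real_asymp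
  have lim_a: "a \<longlonglongrightarrow> 1" unfolding a_def using tendsto_diff[OF tendsto_const tendsto_mult_right[OF lim], of 1 "real n * R"] by simp
  define c where "c p = a p * ((1 - exp (- (\<theta> / a p) * R)) / R)" for p
  \<comment> \<open>Positivity of \<open>a p\<close> and \<open>1 - \<epsilon> p * s\<close> is
    available for large \<open>p\<close>, which is enough for the limit.\<close>
  have ev: "\<forall>\<^sub>F p in sequentially. a p * (1 - \<epsilon> p * s) ^ (2 * p) * P.prob ?E \<le> exp (- c p) ^ n * real m"
  proof -
    have "\<forall>\<^sub>F p in sequentially. a p > 0" using lim_a by (rule order_tendstoD) simp
    moreover have "\<forall>\<^sub>F p in sequentially. 1 - \<epsilon> p * s > 0"
      by (rule order_tendstoD(1)[of _ 1]) (auto intro!: tendsto_eq_intros lim)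
    ultimately show ?thesis
    proof eventually_elim
      case (elim p)
      have eps: "\<epsilon> p > 0" using assms by (simp add: \<epsilon>_def)
      have theta: "\<epsilon> p * real (Suc (2 * p)) = \<theta>" by (simp add: \<epsilon>_def)
      have ale: "\<epsilon> p * (real n * R) \<le> 1 - a p" by (simp add: a_def)
      let ?K = "a p * (1 - \<epsilon> p * s) ^ (2 * p)"
      have K: "?K \<ge> 0" using elim by simp
      have "ennreal (?K * P.prob ?E) = ennreal ?K * emeasure ?P ?E"
        using K by (simp add: ennreal_mult P.emeasure_eq_measure)
      also have "\<dots> = (\<integral>\<^sup>+xs. ennreal ?K * indicator ?E xs \<partial>?P)"
        using E by (simp add: nn_integral_cmult_indicator)
      also have "\<dots> \<le> (\<integral>\<^sup>+xs. ennreal (tr_pow m (shifted (\<epsilon> p) (gsum n xs)) (Suc (2 * p))) \<partial>?P)"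
      proof (rule nn_integral_mono)
        fix xs
        show "ennreal ?K * indicator ?E xs \<le> ennreal (tr_pow m (shifted (\<epsilon> p) (gsum n xs)) (Suc (2 * p)))"
        proof (cases "xs \<in> ?E")
          case True
          let ?l = "lambda_min m (gsum n xs)"
          have l: "?l < s" using True by simp
          obtain u where u: "dot m u u > 0" "\<And>j. j < m \<Longrightarrow> mv m (gsum n xs) u j = ?l * u j"
            using eigenvalues_matE[OF lambda_min_in_eigenvalues[OF m_pos symm_gsum[of n xs]]] by blast
          have "1 - \<epsilon> p * s \<le> 1 - \<epsilon> p * ?l" using l eps by simp
          then have "?K \<le> a p * (1 - \<epsilon> p * ?l) ^ (2 * p)"
            using elim by (intro mult_left_mono power_mono) auto
          also have "\<dots> \<le> tr_pow m (shifted (\<epsilon> p) (gsum n xs)) (Suc (2 * p))"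
            using eps by (intro tr_pow_shifted_ge_eigenvalue[OF symm_gsum gsum_le elim(1) ale _ u(2) u(1)]) auto
          finally show ?thesis using True by (simp add: ennreal_leI)
        qed simp
      qed
      also have "\<dots> \<le> ennreal (exp (- c p) ^ n * real m)"
        using nn_integral_tr_pow_le[OF elim(1) ale eps order_refl, of p, unfolded theta]
        by (simp only: c_def)
      finally show ?case by (simp only: ennreal_le_iff[OF mult_nonneg_nonneg] zero_le_power exp_ge_zero of_nat_0_le_iff)
    qed
  qed
  have "(\<lambda>p. a p * (1 - \<epsilon> p * s) ^ (2 * p) * P.prob ?E) \<longlonglongrightarrow> 1 * exp (- (\<theta> * s)) * P.prob ?E"
  proof -
    have "(\<lambda>p. (1 - \<epsilon> p * s) ^ (2 * p)) \<longlonglongrightarrow> exp (- (\<theta> * s))"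
      using one_minus_divide_power_tendsto_exp[of "\<theta> * s"] by (simp add: \<epsilon>_def)
    then show ?thesis by (intro tendsto_intros lim_a)
  qed
  moreover have "(\<lambda>p. exp (- c p) ^ n * real m) \<longlonglongrightarrow> exp (- (1 * ((1 - exp (- (\<theta> / 1) * R)) / R))) ^ n * real m"
    unfolding c_def using R_pos by (intro tendsto_intros lim_a) auto
  ultimately have "1 * exp (- (\<theta> * s)) * P.prob ?E \<le> exp (- (1 * ((1 - exp (- (\<theta> / 1) * R)) / R))) ^ n * real m"
    using ev by (intro tendsto_le[OF sequentially_bot]) auto
  then have "exp (- (\<theta> * s)) * P.prob ?E \<le> real m * exp (- real n * ((1 - exp (- \<theta> * R)) / R))"
    by (simp add: mult.commute flip: exp_of_nat_mult)
  then have "exp (\<theta> * s) * (exp (- (\<theta> * s)) * P.prob ?E)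
      \<le> exp (\<theta> * s) * (real m * exp (- real n * ((1 - exp (- \<theta> * R)) / R)))"
    by (intro mult_left_mono) auto
  moreover have "exp (\<theta> * s) * (exp (- (\<theta> * s)) * x) = x" for x
    by (simp add: exp_minus)
  moreover have "exp (\<theta> * s) * (real m * exp (- real n * x)) = real m * exp (\<theta> * s - real n * x)" for x
    by (simp add: exp_diff exp_minus field_simps)
  ultimately show ?thesis by (simp only:)
qed

text \<open>The exponent is optimal at this value of \<open>\<theta>\<close>.\<close>

lemma prob_lambda_min_ge:
  assumes "0 < \<delta>" "\<delta> < 1"
  shows "1 - real m * exp (- real n * c_delta \<delta> / R)
    \<le> measure (PiM {..<n} (\<lambda>_. N))
        {xs \<in> space (PiM {..<n} (\<lambda>_. N)). real n * (1 - \<delta>) \<le> lambda_min m (gsum n xs)}"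
proof -
  let ?P = "PiM {..<n} (\<lambda>_. N)"
  let ?E = "{xs \<in> space ?P. real n * (1 - \<delta>) \<le> lambda_min m (gsum n xs)}"
  interpret P: prob_space ?P by (intro prob_space_PiM prob_space_axioms)
  define \<theta> where "\<theta> = - ln (1 - \<delta>) / R"
  have "\<theta> > 0" using assms R_pos by (simp add: \<theta>_def ln_less_zero divide_neg_pos)
  have "exp (- \<theta> * R) = 1 - \<delta>" using assms R_pos by (simp add: \<theta>_def)
  have e: "\<theta> * (real n * (1 - \<delta>)) - real n * ((1 - exp (- \<theta> * R)) / R) = - real n * c_delta \<delta> / R"
    unfolding \<open>exp (- \<theta> * R) = 1 - \<delta>\<close> using R_pos by (simp add: \<theta>_def c_delta_def field_simps)
  have "space ?P - ?E = {xs \<in> space ?P. lambda_min m (gsum n xs) < real n * (1 - \<delta>)}" by auto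
  then have "1 - P.prob ?E \<le> real m * exp (- real n * c_delta \<delta> / R)"
    using prob_lambda_min_less[OF \<open>\<theta> > 0\<close>, of n "real n * (1 - \<delta>)"]
      P.prob_compl[OF lambda_min_event_measurable[of n "real n * (1 - \<delta>)"]] unfolding e by simp
  then show ?thesis by linarith
qed

end

section \<open>Weighted least squares\<close>

text \<open>Pythagoras for the empirical norm: the cross term vanishes by orthogonality, and the
  Gram form at \<open>e\<close> is the empirical squared norm of the linear combination.\<close>

lemma emp_sq_orthogonal:
  assumes orth: "\<And>j. j < m \<Longrightarrow> (\<Sum>i<n. r (xs i) * \<phi> j (xs i) / w (xs i)) = 0"
  shows "emp_sq w n xs (\<lambda>x. r x - (\<Sum>j<m. e j * \<phi> j x))
    = emp_sq w n xs r + dot m e (mv m (gram w \<phi> n xs) e)"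
proof -
  let ?h = "\<lambda>x. \<Sum>j<m. e j * \<phi> j x"
  have "(\<Sum>i<n. r (xs i) * ?h (xs i) / w (xs i)) = (\<Sum>j<m. e j * (\<Sum>i<n. r (xs i) * \<phi> j (xs i) / w (xs i)))"
    unfolding sum_distrib_left sum_divide_distrib
    by (subst sum.swap) (simp add: ac_simps)
  then have cross: "(\<Sum>i<n. r (xs i) * ?h (xs i) / w (xs i)) = 0" by (simp add: orth)
  have "dot m e (mv m (gram w \<phi> n xs) e)
      = (\<Sum>j<m. \<Sum>k<m. \<Sum>i<n. (1 / real n) * ((e j * \<phi> j (xs i)) * (e k * \<phi> k (xs i)) / w (xs i)))"
    unfolding dot_def mv_def gram_def sum_distrib_left sum_distrib_right
    by (intro sum.cong refl) (simp add: ac_simps)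
  also have "\<dots> = (\<Sum>j<m. \<Sum>i<n. \<Sum>k<m. (1 / real n) * ((e j * \<phi> j (xs i)) * (e k * \<phi> k (xs i)) / w (xs i)))"
    by (intro sum.cong refl sum.swap)
  also have "\<dots> = (\<Sum>i<n. \<Sum>j<m. \<Sum>k<m. (1 / real n) * ((e j * \<phi> j (xs i)) * (e k * \<phi> k (xs i)) / w (xs i)))"
    by (rule sum.swap)
  also have "\<dots> = (1 / real n) * (\<Sum>i<n. (?h (xs i))\<^sup>2 / w (xs i))"
  proof -
    have "(?h x)\<^sup>2 = (\<Sum>j<m. \<Sum>k<m. (e j * \<phi> j x) * (e k * \<phi> k x))" for x
      unfolding power2_eq_square by (rule sum_product)
    then show ?thesis by (simp only: sum_distrib_left sum_divide_distrib)
  qed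
  finally have sq: "dot m e (mv m (gram w \<phi> n xs) e) = (1 / real n) * (\<Sum>i<n. (?h (xs i))\<^sup>2 / w (xs i))" .
  have "(\<Sum>i<n. (r (xs i) - ?h (xs i))\<^sup>2 / w (xs i))
      = (\<Sum>i<n. (r (xs i))\<^sup>2 / w (xs i)) - 2 * (\<Sum>i<n. r (xs i) * ?h (xs i) / w (xs i))
        + (\<Sum>i<n. (?h (xs i))\<^sup>2 / w (xs i))"
  proof -
    have "(x - y)\<^sup>2 / v = x\<^sup>2 / v - 2 * (x * y / v) + y\<^sup>2 / v" for x y v :: real
      by (simp add: power2_diff add_divide_distrib diff_divide_distrib)
    then show ?thesis by (simp only: sum.distrib sum_subtractf sum_distrib_left[symmetric])
  qed
  then show ?thesis unfolding emp_sq_def sq cross by (simp add: algebra_simps add_divide_distrib)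
qed

lemma sum_in_Vm: "(\<lambda>x. \<Sum>j<m. c j * \<phi> j x) \<in> Vm \<phi> m"
  unfolding Vm_def by (rule CollectI, rule exI, rule refl)

lemma emp_sq_nonneg: "(\<And>x. 0 \<le> w x) \<Longrightarrow> 0 \<le> emp_sq w n xs g"
  by (simp add: emp_sq_def sum_nonneg)

lemma dot_self_le_0_imp:
  assumes "dot m u u \<le> 0" "j < m"
  shows "u j = 0"
proof -
  have "dot m u u = 0" using assms(1) dot_self_nonneg[of m u] by linarith
  then show ?thesis using assms(2) by (auto simp: dot_def sum_nonneg_eq_0_iff)
qed

text \<open>The least squares solution, relative to an arbitrary element \<open>\<Sum>j<m. a j * \<phi> j\<close> of the
  space: the correction \<open>d\<close> solves the normal equations of the residual \<open>g\<close>.\<close>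

lemma hatP_correction:
  fixes w f :: "'a \<Rightarrow> real" and \<phi> :: "nat \<Rightarrow> 'a \<Rightarrow> real" and a :: "nat \<Rightarrow> real"
    and n :: nat and xs :: "nat \<Rightarrow> 'a" and m :: nat
  assumes gamma: "\<gamma> > 0" and ge: "\<And>u. \<gamma> * dot m u u \<le> dot m u (mv m (gram w \<phi> n xs) u)"
    and w: "\<And>x. 0 \<le> w x"
  defines "g \<equiv> \<lambda>x. f x - (\<Sum>j<m. a j * \<phi> j x)"
  defines "b \<equiv> \<lambda>j. (1 / real n) * (\<Sum>i<n. g (xs i) * \<phi> j (xs i) / w (xs i))"
  obtains d where "hatP w \<phi> m n xs f = (\<lambda>x. \<Sum>j<m. (a j + d j) * \<phi> j x)"
    and "dot m d d \<le> emp_sq w n xs g / \<gamma>" and "dot m d d \<le> dot m b b / \<gamma>\<^sup>2"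
proof -
  let ?G = "gram w \<phi> n xs"
  obtain d where d: "\<And>j. j < m \<Longrightarrow> mv m ?G d j = b j"
    using coercive_solvable[of \<gamma> m ?G b, OF gamma ge] by blast
  \<comment> \<open>The residual after the correction; the normal equations make it orthogonal to
    the basis in the empirical inner product.\<close>
  define r where "r x = g x - (\<Sum>j<m. d j * \<phi> j x)" for x
  have orth: "(\<Sum>i<n. r (xs i) * \<phi> j (xs i) / w (xs i)) = 0" if "j < m" for j
  \<comment> \<open>For \<open>n = 0\<close> the sum is empty; otherwise the factors
    \<open>1 / n\<close> in the Gram matrix and in \<open>b\<close> cancel.\<close>
  proof (cases "n = 0")
    case False
    have "(\<Sum>i<n. r (xs i) * \<phi> j (xs i) / w (xs i)) = (\<Sum>i<n. g (xs i) * \<phi> j (xs i) / w (xs i))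
        - (\<Sum>i<n. \<Sum>k<m. d k * (\<phi> j (xs i) * \<phi> k (xs i) / w (xs i)))"
      unfolding r_def left_diff_distrib diff_divide_distrib sum_subtractf sum_distrib_right sum_divide_distrib
      by (simp add: ac_simps)
    also have "(\<Sum>i<n. \<Sum>k<m. d k * (\<phi> j (xs i) * \<phi> k (xs i) / w (xs i))) = real n * mv m ?G d j"
      unfolding mv_def gram_def sum_distrib_left sum_distrib_right using False
      by (subst sum.swap) (simp add: ac_simps)
    also have "(\<Sum>i<n. g (xs i) * \<phi> j (xs i) / w (xs i)) = real n * b j"
      using False by (simp add: b_def)
    finally show ?thesis using d[OF that] by simp
  qed simp
  let ?p = "\<lambda>x. \<Sum>j<m. (a j + d j) * \<phi> j x"
  \<comment> \<open>The empirical error as a quadratic polynomial centred at \<open>a + d\<close>.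
    It gives minimality and uniqueness and, at \<open>c = a\<close>, the first bound on
    \<open>d\<close>.\<close>
  have expand: "emp_sq w n xs (\<lambda>x. f x - (\<Sum>j<m. c j * \<phi> j x))
      = emp_sq w n xs r + dot m (\<lambda>j. c j - (a j + d j)) (mv m ?G (\<lambda>j. c j - (a j + d j)))" for c
  proof -
    have "(\<lambda>x. f x - (\<Sum>j<m. c j * \<phi> j x)) = (\<lambda>x. r x - (\<Sum>j<m. (c j - (a j + d j)) * \<phi> j x))"
      by (simp add: r_def g_def left_diff_distrib distrib_right sum.distrib sum_subtractf)
    then show ?thesis using emp_sq_orthogonal[where r = r and xs = xs and \<phi> = \<phi> and w = w, OF orth] by simp
  qed
  have p: "emp_sq w n xs (\<lambda>x. f x - ?p x) = emp_sq w n xs r"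
    using expand[of "\<lambda>j. a j + d j"] by (simp only: diff_self) (simp add: dot_def)
  have nonneg: "0 \<le> dot m u (mv m ?G u)" for u
    using ge[of u] gamma by (meson dot_self_nonneg less_imp_le mult_nonneg_nonneg order_trans)
  have hat: "hatP w \<phi> m n xs f = ?p"
    unfolding hatP_def
  proof (rule the_equality)
    show "?p \<in> Vm \<phi> m \<and> (\<forall>h\<in>Vm \<phi> m. emp_sq w n xs (\<lambda>x. f x - ?p x) \<le> emp_sq w n xs (\<lambda>x. f x - h x))"
    proof (intro conjI ballI)
      show "?p \<in> Vm \<phi> m" by (rule sum_in_Vm)
      fix h assume "h \<in> Vm \<phi> m"
      then obtain c where "h = (\<lambda>x. \<Sum>j<m. c j * \<phi> j x)" unfolding Vm_def by blast
      show "emp_sq w n xs (\<lambda>x. f x - ?p x) \<le> emp_sq w n xs (\<lambda>x. f x - h x)"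
        unfolding \<open>h = _\<close>
        using expand[of c] nonneg[of "\<lambda>j. c j - (a j + d j)"] p by linarith
    qed
  next
    fix h assume h: "h \<in> Vm \<phi> m \<and> (\<forall>h'\<in>Vm \<phi> m. emp_sq w n xs (\<lambda>x. f x - h x) \<le> emp_sq w n xs (\<lambda>x. f x - h' x))"
    then obtain c where c: "h = (\<lambda>x. \<Sum>j<m. c j * \<phi> j x)" unfolding Vm_def by blast
    have "?p \<in> Vm \<phi> m" by (rule sum_in_Vm)
    from bspec[OF conjunct2[OF h] this]
    have "emp_sq w n xs (\<lambda>x. f x - h x) \<le> emp_sq w n xs (\<lambda>x. f x - ?p x)" .
    then have "dot m (\<lambda>j. c j - (a j + d j)) (mv m ?G (\<lambda>j. c j - (a j + d j))) \<le> 0"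
      unfolding c using expand[of c] p by linarith
    then have "\<gamma> * dot m (\<lambda>j. c j - (a j + d j)) (\<lambda>j. c j - (a j + d j)) \<le> 0"
      using ge[of "\<lambda>j. c j - (a j + d j)"] by linarith
    then have "dot m (\<lambda>j. c j - (a j + d j)) (\<lambda>j. c j - (a j + d j)) \<le> 0"
      using gamma by (simp add: mult_le_0_iff)
    from dot_self_le_0_imp[OF this] have "c j = a j + d j" if "j < m" for j using that by simp
    then show "h = ?p" unfolding c by (intro ext sum.cong) simp_all
  qed
  have dGd: "\<gamma> * dot m d d \<le> dot m d (mv m ?G d)" by (rule ge)
  have "emp_sq w n xs g = emp_sq w n xs r + dot m (\<lambda>j. - d j) (mv m ?G (\<lambda>j. - d j))"
    using expand[of a] unfolding g_def by simp
  also have "dot m (\<lambda>j. - d j) (mv m ?G (\<lambda>j. - d j)) = dot m d (mv m ?G d)"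
    by (simp add: dot_def mv_def sum_negf)
  finally have 1: "\<gamma> * dot m d d \<le> emp_sq w n xs g"
    using dGd emp_sq_nonneg[of w n xs r, OF w] by simp
  \<comment> \<open>Coercivity gives \<open>\<gamma> |d|^2 \<le> d \<bullet> b\<close>; square,
    apply Cauchy-Schwarz and cancel \<open>|d|^2\<close>.\<close>
  have 2: "\<gamma>\<^sup>2 * dot m d d \<le> dot m b b"
  proof (cases "dot m d d = 0")
    case False
    then have pos: "dot m d d > 0" using dot_self_nonneg[of m d] by linarith
    have "dot m d (mv m ?G d) = dot m d b" by (intro dot_cong d refl)
    then have "\<gamma> * dot m d d \<le> dot m d b" using dGd by simp
    then have "(\<gamma> * dot m d d)\<^sup>2 \<le> (dot m d b)\<^sup>2" using gamma by (intro power_mono) auto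
    also have "\<dots> \<le> dot m d d * dot m b b" by (rule dot_Cauchy_Schwarz)
    finally have "dot m d d * (\<gamma>\<^sup>2 * dot m d d) \<le> dot m d d * dot m b b"
      by (simp add: power2_eq_square ac_simps)
    then show ?thesis using pos by simp
  qed simp
  show ?thesis
  proof (rule that[OF hat])
    show "dot m d d \<le> emp_sq w n xs g / \<gamma>"
      using 1 gamma by (simp add: pos_le_divide_eq mult.commute)
    show "dot m d d \<le> dot m b b / \<gamma>\<^sup>2"
      using 2 gamma by (simp add: pos_le_divide_eq mult.commute)
  qed
qed

section \<open>Square integrability and Pythagoras under the reference measure\<close>

lemma integrable_mult_of_squares:
  fixes f g :: "'a \<Rightarrow> real"
  assumes [measurable]: "f \<in> borel_measurable M" "g \<in> borel_measurable M"
    and "integrable M (\<lambda>x. (f x)\<^sup>2)" "integrable M (\<lambda>x. (g x)\<^sup>2)"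
  shows "integrable M (\<lambda>x. f x * g x)"
proof (rule Bochner_Integration.integrable_bound)
  show "integrable M (\<lambda>x. (f x)\<^sup>2 + (g x)\<^sup>2)" using assms by simp
  show "AE x in M. norm (f x * g x) \<le> norm ((f x)\<^sup>2 + (g x)\<^sup>2)"
  proof (rule AE_I2)
    fix x
    have "2 * (\<bar>f x\<bar> * \<bar>g x\<bar>) \<le> (f x)\<^sup>2 + (g x)\<^sup>2"
      using sum_squares_bound[of "\<bar>f x\<bar>" "\<bar>g x\<bar>"] by (simp add: mult.assoc)
    moreover have "0 \<le> \<bar>f x\<bar> * \<bar>g x\<bar>" by simp
    ultimately have "\<bar>f x\<bar> * \<bar>g x\<bar> \<le> (f x)\<^sup>2 + (g x)\<^sup>2" by linarith
    then show "norm (f x * g x) \<le> norm ((f x)\<^sup>2 + (g x)\<^sup>2)" by (simp add: abs_mult)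
  qed
qed measurable

lemma square_diff_sum_expand:
  fixes x :: real
  shows "(x - (\<Sum>j<m. c j * y j))\<^sup>2 = x\<^sup>2 - 2 * (\<Sum>j<m. c j * (x * y j))
      + (\<Sum>j<m. \<Sum>k<m. (c j * c k) * (y j * y k))"
  by (simp add: power2_diff) (simp add: power2_eq_square sum_product sum_distrib_left ac_simps)

context
  fixes M :: "'a measure" and \<phi> :: "nat \<Rightarrow> 'a \<Rightarrow> real" and m :: nat and g :: "'a \<Rightarrow> real"
  assumes phi_meas: "\<And>j. j < m \<Longrightarrow> \<phi> j \<in> borel_measurable M"
    and phi_int: "\<And>j k. j < m \<Longrightarrow> k < m \<Longrightarrow> integrable M (\<lambda>x. \<phi> j x * \<phi> k x)"
    and g_meas: "g \<in> borel_measurable M"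
    and g_sq: "integrable M (\<lambda>x. (g x)\<^sup>2)"
begin

lemma integrable_mult_basis: "j < m \<Longrightarrow> integrable M (\<lambda>x. g x * \<phi> j x)"
  using phi_int[of j j]
  by (intro integrable_mult_of_squares g_sq g_meas phi_meas) (auto simp: power2_eq_square)

lemma integrable_basis_sums:
  "integrable M (\<lambda>x. \<Sum>j<m. c j * (g x * \<phi> j x))"
  "j < m \<Longrightarrow> integrable M (\<lambda>x. \<Sum>k<m. (c j * c k) * (\<phi> j x * \<phi> k x))"
  "integrable M (\<lambda>x. \<Sum>j<m. \<Sum>k<m. (c j * c k) * (\<phi> j x * \<phi> k x))"
  by (intro Bochner_Integration.integrable_sum integrable_mult_right integrable_mult_basis phi_int; simp)+

lemma integrable_square_diff_basis: "integrable M (\<lambda>x. (g x - (\<Sum>j<m. c j * \<phi> j x))\<^sup>2)"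
  unfolding square_diff_sum_expand
  by (intro Bochner_Integration.integrable_add Bochner_Integration.integrable_diff
      integrable_mult_right integrable_basis_sums g_sq)

lemma L2sq_orthogonal:
  assumes orth: "\<And>j k. j < m \<Longrightarrow> k < m \<Longrightarrow> (\<integral>x. \<phi> j x * \<phi> k x \<partial>M) = (if j = k then 1 else 0)"
    and g: "\<And>j. j < m \<Longrightarrow> (\<integral>x. g x * \<phi> j x \<partial>M) = 0"
  shows "L2sq M (\<lambda>x. g x - (\<Sum>j<m. c j * \<phi> j x)) = L2sq M g + dot m c c"
proof -
  have "(\<integral>x. (\<Sum>j<m. c j * (g x * \<phi> j x)) \<partial>M) = (\<Sum>j<m. c j * (\<integral>x. g x * \<phi> j x \<partial>M))"
    by (subst Bochner_Integration.integral_sum) (auto intro!: sum.cong integrable_mult_basis)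
  then have e1: "(\<integral>x. (\<Sum>j<m. c j * (g x * \<phi> j x)) \<partial>M) = 0" by (simp add: g)
  have "(\<integral>x. (\<Sum>j<m. \<Sum>k<m. (c j * c k) * (\<phi> j x * \<phi> k x)) \<partial>M)
      = (\<Sum>j<m. \<Sum>k<m. (c j * c k) * (\<integral>x. \<phi> j x * \<phi> k x \<partial>M))"
  proof (subst Bochner_Integration.integral_sum)
    show "(\<Sum>j<m. \<integral>x. (\<Sum>k<m. (c j * c k) * (\<phi> j x * \<phi> k x)) \<partial>M)
      = (\<Sum>j<m. \<Sum>k<m. (c j * c k) * (\<integral>x. \<phi> j x * \<phi> k x \<partial>M))"
      by (intro sum.cong refl, subst Bochner_Integration.integral_sum) (auto intro!: phi_int)
  qed (rule integrable_basis_sums(2), simp)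
  also have "\<dots> = dot m c c"
    unfolding dot_def by (intro sum.cong refl) (simp add: orth if_distrib[of "\<lambda>c. _ * c"] cong: if_cong)
  finally have e2: "(\<integral>x. (\<Sum>j<m. \<Sum>k<m. (c j * c k) * (\<phi> j x * \<phi> k x)) \<partial>M) = dot m c c" .
  show ?thesis
    unfolding L2sq_def square_diff_sum_expand using e1 e2 integrable_basis_sums(1,3)[of c] g_sq by simp
qed

end

section \<open>Expectations over samples and conditioning\<close>

text \<open>Each coordinate of the product measure has law \<open>M\<close>, so linearity of the
  integral gives the bound.\<close>

lemma (in prob_space) nn_integral_mean_le:
  fixes q :: "'a \<Rightarrow> real"
  assumes n: "n > 0" and q: "q \<in> borel_measurable M" "\<And>x. 0 \<le> q x"
    and A: "(\<integral>\<^sup>+x. ennreal (q x) \<partial>M) \<le> ennreal A" "0 \<le> A"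
  shows "(\<integral>\<^sup>+xs. ennreal (1 / real n * (\<Sum>i<n. q (xs i))) \<partial>PiM {..<n} (\<lambda>_. M)) \<le> ennreal A"
proof -
  let ?P = "PiM {..<n} (\<lambda>_. M)"
  have mq: "(\<lambda>xs. q (xs i)) \<in> borel_measurable ?P" if "i < n" for i
    using that by (intro measurable_compose[where f = "\<lambda>xs. xs i" and g = q, OF _ q(1)]) simp_all
  have "(\<integral>\<^sup>+xs. ennreal (q (xs i)) \<partial>?P) = (\<integral>\<^sup>+x. ennreal (q x) \<partial>M)" if "i < n" for i
  proof -
    have "distr ?P M (\<lambda>xs. xs i) = M"
      using that by (intro distr_PiM_component prob_space_axioms) auto
    then have "(\<integral>\<^sup>+x. ennreal (q x) \<partial>M) = (\<integral>\<^sup>+x. ennreal (q x) \<partial>distr ?P M (\<lambda>xs. xs i))" by simp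
    also have "\<dots> = (\<integral>\<^sup>+xs. ennreal (q (xs i)) \<partial>?P)"
      using that q(1) by (intro nn_integral_distr) auto
    finally show ?thesis by simp
  qed
  then have le: "(\<integral>\<^sup>+xs. ennreal (q (xs i)) \<partial>?P) \<le> ennreal A" if "i < n" for i
    using A(1) that by simp
  have "(\<integral>\<^sup>+xs. ennreal (1 / real n * (\<Sum>i<n. q (xs i))) \<partial>?P)
      = (\<integral>\<^sup>+xs. ennreal (1 / real n) * (\<Sum>i<n. ennreal (q (xs i))) \<partial>?P)"
    using q(2) by (intro nn_integral_cong) (simp add: sum_ennreal sum_nonneg flip: ennreal_mult)
  also have "\<dots> = ennreal (1 / real n) * (\<Sum>i<n. \<integral>\<^sup>+xs. ennreal (q (xs i)) \<partial>?P)"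
    using mq by (subst nn_integral_cmult, auto, subst nn_integral_sum, auto)
  also have "\<dots> \<le> ennreal (1 / real n) * (\<Sum>i<n. ennreal A)"
    using le by (intro mult_left_mono sum_mono) auto
  also have "\<dots> = ennreal A"
    using n A(2) by (simp add: ennreal_of_nat_eq_real_of_nat flip: ennreal_mult')
  finally show ?thesis .
qed

text \<open>Variances of independent centred variables add: with the earlier samples fixed, the
  cross term is linear in the new centred values and integrates to 0.\<close>

lemma (in prob_space) nn_integral_sum_squares_le:
  fixes z :: "nat \<Rightarrow> 'a \<Rightarrow> real"
  assumes meas: "\<And>j. j < m \<Longrightarrow> z j \<in> borel_measurable M"
    and sq: "\<And>j. j < m \<Longrightarrow> integrable M (\<lambda>x. (z j x)\<^sup>2)"
    and mean: "\<And>j. j < m \<Longrightarrow> (\<integral>x. z j x \<partial>M) = 0"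
    and C: "(\<integral>x. (\<Sum>j<m. (z j x)\<^sup>2) \<partial>M) \<le> C"
  shows "(\<integral>\<^sup>+xs. ennreal (\<Sum>j<m. (\<Sum>i<l. z j (xs i))\<^sup>2) \<partial>PiM {..<l} (\<lambda>_. M)) \<le> ennreal (real l * C)"
proof (induction l)
  case (Suc l)
  interpret samples: product_prob_space "\<lambda>_::nat. M" "UNIV :: nat set" by unfold_locales
  have C0: "0 \<le> C"
    using C by (rule order_trans[rotated]) (intro integral_nonneg_AE AE_I2 sum_nonneg, simp)
  have zi: "integrable M (z j)" if "j < m" for j
    using square_integrable_imp_integrable[OF meas sq] that by simp
  have mz: "(\<lambda>xs. z j (xs i)) \<in> borel_measurable (PiM I (\<lambda>_. M))" if "j < m" "i \<in> I" for i j and I :: "nat set"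
    using that by (intro measurable_compose[where f = "\<lambda>xs. xs i" and g = "z j", OF _ meas]) simp_all
  have mS: "(\<lambda>xs. \<Sum>j<m. (\<Sum>i<l. z j (xs i))\<^sup>2) \<in> borel_measurable (PiM I (\<lambda>_. M))" if "{..<l} \<subseteq> I" for l :: nat and I
    using that by (intro borel_measurable_sum borel_measurable_power mz) auto
  have ins: "{..<Suc l} = insert l {..<l}" by auto
  have upd: "(\<Sum>i<Suc l. z j ((xs(l := y)) i)) = (\<Sum>i<l. z j (xs i)) + z j y" for j xs y
    by (auto intro!: sum.cong)
  have "(\<integral>\<^sup>+xs. ennreal (\<Sum>j<m. (\<Sum>i<Suc l. z j (xs i))\<^sup>2) \<partial>PiM {..<Suc l} (\<lambda>_. M))
      = (\<integral>\<^sup>+xs. (\<integral>\<^sup>+y. ennreal (\<Sum>j<m. (\<Sum>i<Suc l. z j ((xs(l := y)) i))\<^sup>2) \<partial>M) \<partial>PiM {..<l} (\<lambda>_. M))"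
  proof -
    have "(\<lambda>xs. ennreal (\<Sum>j<m. (\<Sum>i<Suc l. z j (xs i))\<^sup>2))
        \<in> borel_measurable (PiM (insert l {..<l}) (\<lambda>_. M))"
      by (intro measurable_compose[OF _ measurable_ennreal] mS) auto
    from samples.product_nn_integral_insert[OF _ _ this] show ?thesis
      unfolding ins[symmetric] by (simp del: sum.lessThan_Suc fun_upd_apply)
  qed
  also have "\<dots> \<le> (\<integral>\<^sup>+xs. ennreal (\<Sum>j<m. (\<Sum>i<l. z j (xs i))\<^sup>2) + ennreal C \<partial>PiM {..<l} (\<lambda>_. M))"
  proof (rule nn_integral_mono)
    fix xs
    define s where "s j = (\<Sum>i<l. z j (xs i))" for j
    have eq: "(\<Sum>j<m. (s j + z j y)\<^sup>2) = (\<Sum>j<m. (s j)\<^sup>2) + 2 * (\<Sum>j<m. s j * z j y) + (\<Sum>j<m. (z j y)\<^sup>2)" for y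
      by (simp add: power2_sum sum.distrib sum_distrib_left ac_simps)
    have i1: "integrable M (\<lambda>y. \<Sum>j<m. s j * z j y)"
      by (intro Bochner_Integration.integrable_sum integrable_mult_right zi) auto
    have i2: "integrable M (\<lambda>y. \<Sum>j<m. (z j y)\<^sup>2)"
      by (intro Bochner_Integration.integrable_sum sq) auto
    have "(\<integral>y. (\<Sum>j<m. s j * z j y) \<partial>M) = (\<Sum>j<m. s j * (\<integral>y. z j y \<partial>M))"
      by (subst Bochner_Integration.integral_sum) (auto intro!: sum.cong zi)
    then have e1: "(\<integral>y. (\<Sum>j<m. s j * z j y) \<partial>M) = 0" by (simp add: mean)
    have "(\<integral>\<^sup>+y. ennreal (\<Sum>j<m. (s j + z j y)\<^sup>2) \<partial>M) = ennreal (\<integral>y. (\<Sum>j<m. (s j + z j y)\<^sup>2) \<partial>M)"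
      by (intro nn_integral_eq_integral AE_I2 sum_nonneg) (simp_all add: eq i1 i2)
    also have "(\<integral>y. (\<Sum>j<m. (s j + z j y)\<^sup>2) \<partial>M) \<le> (\<Sum>j<m. (s j)\<^sup>2) + C"
      unfolding eq using C by (simp add: i1 i2 e1 prob_space)
    finally show "(\<integral>\<^sup>+y. ennreal (\<Sum>j<m. (\<Sum>i<Suc l. z j ((xs(l := y)) i))\<^sup>2) \<partial>M)
        \<le> ennreal (\<Sum>j<m. (\<Sum>i<l. z j (xs i))\<^sup>2) + ennreal C"
      unfolding upd s_def[symmetric] using C0 by (simp add: ennreal_leI sum_nonneg flip: ennreal_plus)
  qed
  also have "\<dots> = (\<integral>\<^sup>+xs. ennreal (\<Sum>j<m. (\<Sum>i<l. z j (xs i))\<^sup>2) \<partial>PiM {..<l} (\<lambda>_. M)) + ennreal C"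
  proof -
    interpret Pl: prob_space "PiM {..<l} (\<lambda>_. M)" by (intro prob_space_PiM prob_space_axioms)
    show ?thesis
      by (subst nn_integral_add)
         (auto intro!: measurable_compose[OF _ measurable_ennreal] mS simp: Pl.emeasure_space_1)
  qed
  also have "\<dots> \<le> ennreal (real l * C) + ennreal C" using Suc by (intro add_right_mono)
  also have "\<dots> = ennreal (real (Suc l) * C)" using C0 by (simp add: algebra_simps flip: ennreal_plus)
  finally show ?case .
qed simp

text \<open>The constant \<open>A\<close> is weighted by the probability of \<open>S\<close> and
  survives the division unchanged; \<open>Y\<close> is integrated over the whole space, so only
  \<open>B\<close> acquires the factor \<open>1 / q\<close>.\<close>

lemma (in prob_space) cond_exp_le:
  assumes S: "S \<in> sets M" and pos: "0 < q" "q \<le> prob S"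
    and le: "\<And>x. x \<in> S \<Longrightarrow> X x \<le> A + Y x" and A: "0 \<le> A" and Y: "\<And>x. 0 \<le> Y x"
    and [measurable]: "Y \<in> borel_measurable M"
    and B: "(\<integral>\<^sup>+x. ennreal (Y x) \<partial>M) \<le> ennreal B" "0 \<le> B"
  shows "cond_exp M S X \<le> ennreal (A + B / q)"
proof -
  have "(\<integral>\<^sup>+x. ennreal (X x) * indicator S x \<partial>M) \<le> (\<integral>\<^sup>+x. ennreal A * indicator S x + ennreal (Y x) \<partial>M)"
    using le A Y by (intro nn_integral_mono) (auto simp: indicator_def ennreal_leI simp flip: ennreal_plus)
  also have "\<dots> = ennreal A * emeasure M S + (\<integral>\<^sup>+x. ennreal (Y x) \<partial>M)"
    using S by (subst nn_integral_add) (auto simp: nn_integral_cmult_indicator)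
  also have "\<dots> \<le> ennreal A * emeasure M S + ennreal B" using B by (intro add_left_mono)
  also have "\<dots> = ennreal (A * prob S + B)" using A B by (simp add: emeasure_eq_measure ennreal_mult)
  finally have "cond_exp M S X \<le> ennreal (A * prob S + B) / ennreal (prob S)"
    unfolding cond_exp_def emeasure_eq_measure by (rule divide_right_mono_ennreal)
  also have "\<dots> = ennreal ((A * prob S + B) / prob S)"
    using A B pos by (intro divide_ennreal) auto
  also have "(A * prob S + B) / prob S = A + B / prob S" using pos by (simp add: field_simps)
  also have "\<dots> \<le> A + B / q" using pos B by (intro add_left_mono divide_left_mono) auto
  finally show ?thesis by (simp add: ennreal_leI)
qed

text \<open>This is the strict inequality \<open>ln y < y - 1\<close> at
  \<open>y = 1 / (1 - \<delta>)\<close>, multiplied by \<open>1 - \<delta>\<close>.\<close>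

lemma c_delta_pos:
  assumes "0 < \<delta>" "\<delta> < 1"
  shows "c_delta \<delta> > 0"
proof -
  let ?y = "1 / (1 - \<delta>)"
  have y: "0 < ?y" "?y \<noteq> 1" using assms by auto
  have "ln ?y \<noteq> ?y - 1" using ln_eq_minus_one[of ?y] y by blast
  then have "ln ?y < ?y - 1" using ln_le_minus_one[OF y(1)] by simp
  then have "- ln (1 - \<delta>) < \<delta> / (1 - \<delta>)" using assms by (simp add: ln_div field_simps)
  then show ?thesis using assms by (simp add: c_delta_def field_simps)
qed

section \<open>Assembly of the estimates\<close>

theorem mainTheorem5:
  fixes M :: "'a::polish_space measure"
    and \<phi> :: "nat \<Rightarrow> 'a \<Rightarrow> real"
    and w :: "'a \<Rightarrow> real"
    and m n :: nat
    and \<alpha> \<delta> \<eta> :: real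
  assumes prob: "prob_space M"
    and borel: "sets M = sets borel"
    and m_pos: "m \<ge> 1"
    and phi_meas: "\<And>j. j < m \<Longrightarrow> \<phi> j \<in> borel_measurable M"
    and phi_int: "\<And>j k. j < m \<Longrightarrow> k < m \<Longrightarrow> integrable M (\<lambda>x. \<phi> j x * \<phi> k x)"
    and phi_orth: "\<And>j k. j < m \<Longrightarrow> k < m \<Longrightarrow>
                    (\<integral>x. \<phi> j x * \<phi> k x \<partial>M) = (if j = k then 1 else 0)"
    and w_meas: "w \<in> borel_measurable M"
    and w_int: "integrable M w"
    and w_dens: "(\<integral>x. w x \<partial>M) = 1"
    and alpha_pos: "\<alpha> > 0"
    and w_ge: "\<And>x. w x \<ge> \<alpha> * wm \<phi> m x"
    and delta: "0 < \<delta>" "\<delta> < 1"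
    and eta: "0 < \<eta>" "\<eta> < 1"
    and n_ge: "real n \<ge> (1 / c_delta \<delta>) * (1 / \<alpha>) * real m * ln (real m / \<eta>)"
  defines "P \<equiv> PiM {..<n} (\<lambda>_. density M w)"
    and "S \<equiv> {xs \<in> space (PiM {..<n} (\<lambda>_. density M w)). lambda_min m (gram w \<phi> n xs) \<ge> 1 - \<delta>}"
  shows "measure P S \<ge> 1 - \<eta> \<and>
    (\<forall>f. f \<in> borel_measurable M \<longrightarrow> integrable M (\<lambda>x. (f x)\<^sup>2) \<longrightarrow>
       cond_exp P S (\<lambda>xs. L2sq M (\<lambda>x. f x - hatP w \<phi> m n xs f x))
         \<le> ennreal ((1 + 1 / (1 - \<eta>) * (1 / (1 - \<delta>))) *
                     (INF g\<in>Vm \<phi> m. L2sq M (\<lambda>x. f x - g x))) \<and>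
       cond_exp P S (\<lambda>xs. L2sq M (\<lambda>x. f x - hatP w \<phi> m n xs f x))
         \<le> ennreal ((1 + (1 / \<alpha>) * (real m / real n) * (1 / (1 - \<eta>)) * (1 / (1 - \<delta>))\<^sup>2) *
                     (INF g\<in>Vm \<phi> m. L2sq M (\<lambda>x. f x - g x))))"
proof -
  interpret M: prob_space M by (rule prob)
  let ?N = "density M w"
  \<comment> \<open>The domination of \<open>wm\<close> by \<open>w\<close> makes this an upper
    bound for \<open>|\<phi>|^2 / w\<close>.\<close>
  let ?R = "real m / \<alpha>"
  have R: "?R > 0" using m_pos alpha_pos by simp
  have wm0: "0 \<le> wm \<phi> m x" for x by (simp add: wm_def sum_nonneg)
  have w0: "0 \<le> w x" for x
    using w_ge[of x] wm0[of x] alpha_pos by (meson less_imp_le mult_nonneg_nonneg order_trans)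
  have phi_sq: "(\<Sum>j<m. (\<phi> j x)\<^sup>2) \<le> ?R * w x" for x
  proof -
    have "(\<Sum>j<m. (\<phi> j x)\<^sup>2) = real m * wm \<phi> m x" using m_pos by (simp add: wm_def)
    also have "\<dots> = ?R * (\<alpha> * wm \<phi> m x)" using alpha_pos by simp
    also have "\<dots> \<le> ?R * w x" using w_ge[of x] R by (intro mult_left_mono) auto
    finally show ?thesis .
  qed
  \<comment> \<open>Division by 0 yields 0, so zeros of \<open>w\<close> need care: there the basis
    functions vanish too, and multiplication by \<open>w\<close> still undoes the division in
    \<open>w_cancel\<close>.\<close>
  have phi_0: "\<phi> j x = 0" if "w x = 0" "j < m" for j x
  proof -
    have "(\<phi> j x)\<^sup>2 \<le> (\<Sum>j<m. (\<phi> j x)\<^sup>2)" using that(2) by (intro member_le_sum) auto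
    also have "\<dots> \<le> 0" using phi_sq[of x] that(1) by simp
    finally show ?thesis by simp
  qed
  have w_cancel: "w x * (y * \<phi> j x / w x) = y * \<phi> j x" if "j < m" for x y j
    using phi_0[of x j] that by (cases "w x = 0") auto
  have borel_N: "borel_measurable ?N = borel_measurable M"
    by (rule measurable_cong_sets) simp_all
  have int_N: "(\<integral>x. h x \<partial>?N) = (\<integral>x. w x * h x \<partial>M)" if "h \<in> borel_measurable M" for h :: "'a \<Rightarrow> real"
    using that w0 w_meas by (simp add: integral_density)
  have N: "prob_space ?N"
  proof (rule prob_spaceI)
    have "emeasure ?N (space ?N) = (\<integral>\<^sup>+x. ennreal (w x) \<partial>M)"
      using w_meas by (simp add: emeasure_density cong: nn_integral_cong)
    also have "\<dots> = 1" using w_int w_dens w0 by (simp add: nn_integral_eq_integral)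
    finally show "emeasure ?N (space ?N) = 1" .
  qed
  \<comment> \<open>The density of the sampling measure cancels the two factors
    \<open>1 / sqrt w\<close>, so orthonormality is preserved.\<close>
  define V where "V j x = \<phi> j x / sqrt (w x)" for j x
  have V_mult: "V j x * V k x = \<phi> j x * \<phi> k x / w x" for j k x
    using w0[of x] by (simp add: V_def)
  have V_meas: "V j \<in> borel_measurable M" if "j < m" for j
    unfolding V_def using phi_meas[OF that] w_meas by measurable
  interpret D: bounded_isotropic ?N V m ?R
  proof (intro bounded_isotropic.intro bounded_isotropic_axioms.intro N m_pos R)
    show "V j \<in> borel_measurable ?N" if "j < m" for j using V_meas[OF that] by (simp only: borel_N)
    show "(\<integral>x. V j x * V k x \<partial>?N) = (if j = k then 1 else 0)" if "j < m" "k < m" for j k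
    proof -
      have VV: "(\<lambda>x. V j x * V k x) \<in> borel_measurable M"
        by (intro borel_measurable_times V_meas that)
      show ?thesis
        by (subst int_N[OF VV]) (simp only: V_mult w_cancel[OF that(2)] phi_orth[OF that])
    qed
    show "dot m (\<lambda>j. V j x) (\<lambda>j. V j x) \<le> ?R" for x
    proof (cases "w x = 0")
      case False
      then have "w x > 0" using w0[of x] by linarith
      moreover have "dot m (\<lambda>j. V j x) (\<lambda>j. V j x) = (\<Sum>j<m. (\<phi> j x)\<^sup>2) / w x"
        by (simp add: dot_def V_mult sum_divide_distrib power2_eq_square)
      ultimately show ?thesis using phi_sq[of x] by (simp add: pos_divide_le_eq)
    qed (use R in \<open>simp add: dot_def V_def\<close>)
  qed
  interpret P: prob_space P
    unfolding P_def by (intro prob_space_PiM D.prob_space_axioms)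

  have c: "c_delta \<delta> > 0" by (rule c_delta_pos[OF delta])
  have log_pos: "ln (real m / \<eta>) > 0"
  proof (rule ln_gt_zero)
    have "\<eta> < real m" using m_pos eta by linarith
    then show "1 < real m / \<eta>" using eta by (simp add: less_divide_eq)
  qed
  \<comment> \<open>The logarithm is positive because \<open>\<eta> < 1 \<le> m\<close>, so the
    condition on \<open>n\<close> excludes 0.\<close>
  have n: "n > 0"
  proof -
    have "0 < (1 / c_delta \<delta>) * (1 / \<alpha>) * real m * ln (real m / \<eta>)"
      using c alpha_pos m_pos log_pos by (intro mult_pos_pos) auto
    then have "0 < real n" using n_ge by linarith
    then show ?thesis by simp
  qed
  define \<gamma> where "\<gamma> = 1 - \<delta>"
  have gamma: "\<gamma> > 0" using delta by (simp add: \<gamma>_def)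
  have gram: "gram w \<phi> n xs = (\<lambda>j k. 1 / real n * D.gsum n xs j k)" for xs
    by (simp add: gram_def D.gsum_def V_mult fun_eq_iff)
  have quad: "dot m u (mv m (gram w \<phi> n xs) u) = dot m u (mv m (D.gsum n xs) u) / real n" for xs u
  proof -
    have "mv m (gram w \<phi> n xs) u = (\<lambda>j. 1 / real n * mv m (D.gsum n xs) u j)"
      unfolding gram by (simp only: mv_def sum_distrib_left mult.assoc)
    then show ?thesis by (simp only: dot_scale_right) simp
  qed
  have sym: "symm m (gram w \<phi> n xs)" for xs
    using D.symm_gsum by (simp add: symm_def gram)
  \<comment> \<open>The Gram matrix is \<open>gsum\<close> divided by \<open>n\<close>, hence the
    threshold is multiplied by \<open>n\<close>.\<close>
  have S_eq: "S = {xs \<in> space P. real n * \<gamma> \<le> lambda_min m (D.gsum n xs)}"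
    unfolding S_def P_def[symmetric] \<gamma>_def[symmetric] lambda_min_ge_iff[OF m_pos sym]
      lambda_min_ge_iff[OF m_pos D.symm_gsum] quad
    using n by (simp add: pos_le_divide_eq ac_simps)
  have S_sets: "S \<in> sets P"
    unfolding S_eq P_def by (rule D.lambda_min_event_measurable)
  have S_ge: "\<gamma> * dot m u u \<le> dot m u (mv m (gram w \<phi> n xs) u)" if "xs \<in> S" for xs u
    using that unfolding S_def \<gamma>_def[symmetric] lambda_min_ge_iff[OF m_pos sym] by blast
  have prob_S: "1 - \<eta> \<le> P.prob S"
  proof -
    \<comment> \<open>This rearranges the condition on \<open>n\<close> so that the failure bound
      \<open>m * exp (- n * c_delta \<delta> / ?R)\<close> is at most \<eta>.\<close>
    have "ln (real m / \<eta>) \<le> real n * c_delta \<delta> / ?R"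
    proof -
      have "real m * ln (real m / \<eta>)
          = (c_delta \<delta> * \<alpha>) * ((1 / c_delta \<delta>) * (1 / \<alpha>) * real m * ln (real m / \<eta>))"
        using c alpha_pos by simp
      also have "\<dots> \<le> (c_delta \<delta> * \<alpha>) * real n"
        using n_ge c alpha_pos by (intro mult_left_mono) auto
      finally show ?thesis using m_pos by (simp add: pos_le_divide_eq mult.commute mult.left_commute)
    qed
    then have "real m * exp (- real n * c_delta \<delta> / ?R) \<le> real m * exp (- ln (real m / \<eta>))"
      by (intro mult_left_mono) auto
    also have "\<dots> = \<eta>" using eta m_pos by (simp add: exp_minus)
    finally show ?thesis
      using D.prob_lambda_min_ge[OF delta, of n] unfolding S_eq \<gamma>_def P_def by simp
  qed

  show ?thesis
  proof (intro conjI allI impI prob_S)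
    fix f :: "'a \<Rightarrow> real" assume f: "f \<in> borel_measurable M" and f_sq: "integrable M (\<lambda>x. (f x)\<^sup>2)"
    \<comment> \<open>Fourier coefficients of \<open>f\<close>: \<open>g\<close> is the residual of
      the orthogonal projection and \<open>A\<close> its squared norm.\<close>
    define a where "a j = (\<integral>x. f x * \<phi> j x \<partial>M)" for j
    define g where "g x = f x - (\<Sum>j<m. a j * \<phi> j x)" for x
    define A where "A = L2sq M g"
    have g_meas: "g \<in> borel_measurable M"
      unfolding g_def using phi_meas f
      by (intro borel_measurable_diff borel_measurable_sum borel_measurable_times) auto
    have g_sq: "integrable M (\<lambda>x. (g x)\<^sup>2)"
      unfolding g_def by (rule integrable_square_diff_basis[OF phi_meas phi_int f f_sq])
    have g_phi: "integrable M (\<lambda>x. g x * \<phi> j x)" if "j < m" for j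
      by (rule integrable_mult_basis[OF phi_meas phi_int g_meas g_sq that])
    have g_orth: "(\<integral>x. g x * \<phi> j x \<partial>M) = 0" if j: "j < m" for j
    proof -
      have "(\<integral>x. g x * \<phi> j x \<partial>M) = (\<integral>x. f x * \<phi> j x - (\<Sum>k<m. a k * (\<phi> k x * \<phi> j x)) \<partial>M)"
        by (simp add: g_def left_diff_distrib sum_distrib_right mult.assoc)
      also have "\<dots> = a j - (\<Sum>k<m. a k * (\<integral>x. \<phi> k x * \<phi> j x \<partial>M))"
        using integrable_mult_basis[OF phi_meas phi_int f f_sq j] phi_int[OF _ j]
        by (subst Bochner_Integration.integral_diff)
           (auto simp: a_def intro!: Bochner_Integration.integrable_sum integrable_mult_right)
      also have "\<dots> = 0"
        using j by (simp add: phi_orth if_distrib[of "\<lambda>c. _ * c"] cong: if_cong)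
      finally show ?thesis .
    qed
    have pythagoras: "L2sq M (\<lambda>x. g x - (\<Sum>j<m. c j * \<phi> j x)) = A + dot m c c" for c
      unfolding A_def by (rule L2sq_orthogonal[OF phi_meas phi_int g_meas g_sq phi_orth g_orth])
    have A0: "0 \<le> A" by (simp add: A_def L2sq_def)
    \<comment> \<open>Another element \<open>h\<close> changes the residual by an element of the
      space, and Pythagoras adds a nonnegative term.\<close>
    have A_le: "A \<le> (INF g\<in>Vm \<phi> m. L2sq M (\<lambda>x. f x - g x))"
    proof (rule cINF_greatest)
      show "Vm \<phi> m \<noteq> {}" using sum_in_Vm[of "\<lambda>_. 0" \<phi> m] by auto
      fix h assume "h \<in> Vm \<phi> m"
      then obtain c where h: "h = (\<lambda>x. \<Sum>j<m. c j * \<phi> j x)" by (auto simp: Vm_def)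
      have "(\<lambda>x. f x - h x) = (\<lambda>x. g x - (\<Sum>j<m. (c j - a j) * \<phi> j x))"
        by (simp add: h g_def left_diff_distrib sum_subtractf)
      then show "A \<le> L2sq M (\<lambda>x. f x - h x)" using pythagoras[of "\<lambda>j. c j - a j"] by simp
    qed
    \<comment> \<open>The averages of \<open>z j\<close> form the right-hand side of the normal
      equations for \<open>g\<close>; they are centred because \<open>g\<close> is orthogonal to the
      basis.\<close>
    define z where "z j x = g x * \<phi> j x / w x" for j x
    define b where "b xs j = 1 / real n * (\<Sum>i<n. z j (xs i))" for xs j
    have error: "L2sq M (\<lambda>x. f x - hatP w \<phi> m n xs f x) \<le> A + emp_sq w n xs g / \<gamma>"
      "L2sq M (\<lambda>x. f x - hatP w \<phi> m n xs f x) \<le> A + dot m (b xs) (b xs) / \<gamma>\<^sup>2" if xs: "xs \<in> S" for xs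
    proof -
      obtain d where d: "hatP w \<phi> m n xs f = (\<lambda>x. \<Sum>j<m. (a j + d j) * \<phi> j x)"
        and le: "dot m d d \<le> emp_sq w n xs g / \<gamma>" "dot m d d \<le> dot m (b xs) (b xs) / \<gamma>\<^sup>2"
        by (rule hatP_correction[OF gamma S_ge[OF xs] w0, of f a, folded g_def, folded z_def, folded b_def])
      have "(\<lambda>x. f x - hatP w \<phi> m n xs f x) = (\<lambda>x. g x - (\<Sum>j<m. d j * \<phi> j x))"
        by (simp add: d g_def distrib_right sum.distrib diff_diff_eq)
      then have "L2sq M (\<lambda>x. f x - hatP w \<phi> m n xs f x) = A + dot m d d" by (simp add: pythagoras)
      then show "L2sq M (\<lambda>x. f x - hatP w \<phi> m n xs f x) \<le> A + emp_sq w n xs g / \<gamma>"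
        "L2sq M (\<lambda>x. f x - hatP w \<phi> m n xs f x) \<le> A + dot m (b xs) (b xs) / \<gamma>\<^sup>2"
        using le by simp_all
    qed
    have sample_meas: "(\<lambda>xs. q (xs i)) \<in> borel_measurable P" if "q \<in> borel_measurable M" "i < n" for q :: "'a \<Rightarrow> real" and i
      unfolding P_def using that
      by (intro measurable_compose[where f = "\<lambda>xs. xs i" and g = q and N = ?N]) (simp_all add: borel_N)
    have inf_mult: "ennreal (r * A) \<le> ennreal (r * (INF g\<in>Vm \<phi> m. L2sq M (\<lambda>x. f x - g x)))" if "0 \<le> r" for r
      using A_le that by (intro ennreal_leI mult_left_mono)

    \<comment> \<open>First estimate, through the empirical norm of the residual\<close>
    show "cond_exp P S (\<lambda>xs. L2sq M (\<lambda>x. f x - hatP w \<phi> m n xs f x))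
        \<le> ennreal ((1 + 1 / (1 - \<eta>) * (1 / (1 - \<delta>))) * (INF g\<in>Vm \<phi> m. L2sq M (\<lambda>x. f x - g x)))"
    proof -
      define q where "q x = (g x)\<^sup>2 / w x" for x
      have q: "q \<in> borel_measurable M" "\<And>x. 0 \<le> q x"
        unfolding q_def using g_meas w_meas w0 by (auto intro!: borel_measurable_divide borel_measurable_power)
      have emp: "emp_sq w n xs g = 1 / real n * (\<Sum>i<n. q (xs i))" for xs
        by (simp add: emp_sq_def q_def)
      have "(\<integral>\<^sup>+x. ennreal (q x) \<partial>?N) = (\<integral>\<^sup>+x. ennreal (w x) * ennreal (q x) \<partial>M)"
        using q w_meas by (intro nn_integral_density) auto
      also have "\<dots> \<le> (\<integral>\<^sup>+x. ennreal ((g x)\<^sup>2) \<partial>M)"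
      proof (rule nn_integral_mono)
        fix x
        \<comment> \<open>Equality holds where \<open>w x\<close> is nonzero; at a zero of
          \<open>w\<close> the left side is 0.\<close>
        have "w x * q x \<le> (g x)\<^sup>2" by (simp add: q_def)
        then show "ennreal (w x) * ennreal (q x) \<le> ennreal ((g x)\<^sup>2)"
          using w0[of x] q(2)[of x] by (simp add: ennreal_leI flip: ennreal_mult)
      qed
      also have "\<dots> = ennreal A" using g_sq by (simp add: nn_integral_eq_integral A_def L2sq_def)
      finally have "(\<integral>\<^sup>+xs. ennreal (emp_sq w n xs g) \<partial>P) \<le> ennreal A"
        unfolding emp P_def using D.nn_integral_mean_le[OF n _ q(2) _ A0] q(1) by (simp only: borel_N)
      then have mean: "ennreal (1 / \<gamma>) * (\<integral>\<^sup>+xs. ennreal (emp_sq w n xs g) \<partial>P) \<le> ennreal (1 / \<gamma>) * ennreal A"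
        by (rule mult_left_mono) simp
      have meas: "(\<lambda>xs. emp_sq w n xs g) \<in> borel_measurable P"
        unfolding emp by (intro borel_measurable_times borel_measurable_sum borel_measurable_const sample_meas q) auto
      have emp_0: "0 \<le> emp_sq w n xs g" for xs by (rule emp_sq_nonneg[OF w0])
      have "(\<integral>\<^sup>+xs. ennreal (emp_sq w n xs g / \<gamma>) \<partial>P)
          = (\<integral>\<^sup>+xs. ennreal (1 / \<gamma>) * ennreal (emp_sq w n xs g) \<partial>P)"
        using gamma emp_0 by (intro nn_integral_cong) (simp flip: ennreal_mult)
      also have "\<dots> = ennreal (1 / \<gamma>) * (\<integral>\<^sup>+xs. ennreal (emp_sq w n xs g) \<partial>P)"
        using meas by (intro nn_integral_cmult) simp
      also note mean
      also have "ennreal (1 / \<gamma>) * ennreal A = ennreal (A / \<gamma>)"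
        using gamma A0 by (simp flip: ennreal_mult)
      finally have int: "(\<integral>\<^sup>+xs. ennreal (emp_sq w n xs g / \<gamma>) \<partial>P) \<le> ennreal (A / \<gamma>)" .
      have "cond_exp P S (\<lambda>xs. L2sq M (\<lambda>x. f x - hatP w \<phi> m n xs f x)) \<le> ennreal (A + A / \<gamma> / (1 - \<eta>))"
      proof (rule P.cond_exp_le[where Y = "\<lambda>xs. emp_sq w n xs g / \<gamma>"])
        show "(\<lambda>xs. emp_sq w n xs g / \<gamma>) \<in> borel_measurable P" using meas by simp
      qed (use eta prob_S A0 gamma emp_0 S_sets int error(1) in simp_all)
      also have "A + A / \<gamma> / (1 - \<eta>) = (1 + 1 / (1 - \<eta>) * (1 / (1 - \<delta>))) * A"
        by (simp add: \<gamma>_def distrib_left distrib_right mult.commute)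
      also have "ennreal \<dots> \<le> ennreal ((1 + 1 / (1 - \<eta>) * (1 / (1 - \<delta>))) * (INF g\<in>Vm \<phi> m. L2sq M (\<lambda>x. f x - g x)))"
        using eta delta by (intro inf_mult) auto
      finally show ?thesis .
    qed

    \<comment> \<open>Second estimate, through the variance of the normal equations\<close>
    show "cond_exp P S (\<lambda>xs. L2sq M (\<lambda>x. f x - hatP w \<phi> m n xs f x))
        \<le> ennreal ((1 + (1 / \<alpha>) * (real m / real n) * (1 / (1 - \<eta>)) * (1 / (1 - \<delta>))\<^sup>2)
             * (INF g\<in>Vm \<phi> m. L2sq M (\<lambda>x. f x - g x)))"
    proof -
      have z_meas: "z j \<in> borel_measurable M" if "j < m" for j
        unfolding z_def using g_meas w_meas phi_meas[OF that] by measurable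
      have wz: "w x * z j x = g x * \<phi> j x" if "j < m" for j x
        unfolding z_def by (rule w_cancel[OF that])
      \<comment> \<open>The sum is \<open>(g x)\<^sup>2\<close> times \<open>|\<phi>|^2 / w\<close>,
        and the latter quotient is at most \<open>?R\<close>.\<close>
      have wz_sq: "w x * (\<Sum>j<m. (z j x)\<^sup>2) \<le> ?R * (g x)\<^sup>2" for x
      proof (cases "w x = 0")
        case False
        then have pos: "w x > 0" using w0[of x] by linarith
        have "w x * (\<Sum>j<m. (z j x)\<^sup>2) = (g x)\<^sup>2 * ((\<Sum>j<m. (\<phi> j x)\<^sup>2) / w x)"
          using False unfolding z_def sum_distrib_left sum_divide_distrib
          by (intro sum.cong refl) (simp add: power2_eq_square)
        also have "\<dots> \<le> (g x)\<^sup>2 * ?R"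
          using phi_sq[of x] pos by (intro mult_left_mono) (simp_all add: pos_divide_le_eq)
        finally show ?thesis by (simp add: mult.commute)
      qed (use alpha_pos in simp)
      have int_wz: "integrable M (\<lambda>x. w x * (z j x)\<^sup>2)" if j: "j < m" for j
      proof (rule Bochner_Integration.integrable_bound)
        show "integrable M (\<lambda>x. ?R * (g x)\<^sup>2)" using g_sq by (rule integrable_mult_right)
        show "(\<lambda>x. w x * (z j x)\<^sup>2) \<in> borel_measurable M" using w_meas z_meas[OF j] by measurable
        show "AE x in M. norm (w x * (z j x)\<^sup>2) \<le> norm (?R * (g x)\<^sup>2)"
        proof (rule AE_I2)
          fix x
          have "(z j x)\<^sup>2 \<le> (\<Sum>j<m. (z j x)\<^sup>2)" using j by (intro member_le_sum) auto
          then have "w x * (z j x)\<^sup>2 \<le> w x * (\<Sum>j<m. (z j x)\<^sup>2)" using w0 by (rule mult_left_mono)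
          then have "w x * (z j x)\<^sup>2 \<le> ?R * (g x)\<^sup>2" using wz_sq[of x] by linarith
          moreover have "0 \<le> w x * (z j x)\<^sup>2" using w0[of x] by simp
          ultimately show "norm (w x * (z j x)\<^sup>2) \<le> norm (?R * (g x)\<^sup>2)"
            by (simp only: real_norm_def abs_of_nonneg)
        qed
      qed
      \<comment> \<open>The second moment grows like \<open>n\<close> rather than its square;
        division by \<open>(n * \<gamma>)\<^sup>2\<close> then produces the factor
        \<open>m / n\<close>.\<close>
      have sum_eq: "(\<integral>\<^sup>+xs. ennreal (\<Sum>j<m. (\<Sum>i<n. z j (xs i))\<^sup>2) \<partial>P) \<le> ennreal (real n * (?R * A))"
        unfolding P_def
      proof (rule D.nn_integral_sum_squares_le)
        show "z j \<in> borel_measurable ?N" if "j < m" for j using z_meas[OF that] by (simp only: borel_N)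
        show "integrable ?N (\<lambda>x. (z j x)\<^sup>2)" if "j < m" for j
          using int_wz[OF that] z_meas[OF that] w_meas w0 by (simp add: integrable_density)
        show "(\<integral>x. z j x \<partial>?N) = 0" if "j < m" for j
          using g_orth[OF that] by (simp add: int_N[OF z_meas[OF that]] wz[OF that])
        have "(\<integral>x. (\<Sum>j<m. (z j x)\<^sup>2) \<partial>?N) = (\<integral>x. w x * (\<Sum>j<m. (z j x)\<^sup>2) \<partial>M)"
          by (intro int_N borel_measurable_sum borel_measurable_power z_meas) simp
        also have "\<dots> \<le> (\<integral>x. ?R * (g x)\<^sup>2 \<partial>M)"
        proof (rule integral_mono)
          show "integrable M (\<lambda>x. w x * (\<Sum>j<m. (z j x)\<^sup>2))"
            unfolding sum_distrib_left by (intro Bochner_Integration.integrable_sum int_wz) simp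
          show "integrable M (\<lambda>x. ?R * (g x)\<^sup>2)" using g_sq by (rule integrable_mult_right)
        qed (rule wz_sq)
        also have "\<dots> = ?R * A" by (simp add: A_def L2sq_def)
        finally show "(\<integral>x. (\<Sum>j<m. (z j x)\<^sup>2) \<partial>?N) \<le> ?R * A" .
      qed
      have b_sq: "dot m (b xs) (b xs) / \<gamma>\<^sup>2 = (1 / (real n * \<gamma>)\<^sup>2) * (\<Sum>j<m. (\<Sum>i<n. z j (xs i))\<^sup>2)" for xs
        unfolding dot_def sum_divide_distrib sum_distrib_left
        by (intro sum.cong refl) (simp add: b_def power2_eq_square)
      have meas: "(\<lambda>xs. \<Sum>j<m. (\<Sum>i<n. z j (xs i))\<^sup>2) \<in> borel_measurable P"
        by (intro borel_measurable_power borel_measurable_sum sample_meas z_meas) auto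
      have "(\<integral>\<^sup>+xs. ennreal (dot m (b xs) (b xs) / \<gamma>\<^sup>2) \<partial>P)
          = ennreal (1 / (real n * \<gamma>)\<^sup>2) * (\<integral>\<^sup>+xs. ennreal (\<Sum>j<m. (\<Sum>i<n. z j (xs i))\<^sup>2) \<partial>P)"
      proof -
        have "ennreal (dot m (b xs) (b xs) / \<gamma>\<^sup>2)
            = ennreal (1 / (real n * \<gamma>)\<^sup>2) * ennreal (\<Sum>j<m. (\<Sum>i<n. z j (xs i))\<^sup>2)" for xs
          unfolding b_sq by (rule ennreal_mult) (auto intro: sum_nonneg)
        then show ?thesis using meas by (simp only: nn_integral_cmult measurable_compose[OF _ measurable_ennreal])
      qed
      also have "\<dots> \<le> ennreal (1 / (real n * \<gamma>)\<^sup>2) * ennreal (real n * (?R * A))"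
        using sum_eq by (rule mult_left_mono) simp
      also have "\<dots> = ennreal (?R * A / (real n * \<gamma>\<^sup>2))"
        using n A0 alpha_pos gamma by (subst ennreal_mult[symmetric]) (simp_all add: power2_eq_square ac_simps)
      finally have int: "(\<integral>\<^sup>+xs. ennreal (dot m (b xs) (b xs) / \<gamma>\<^sup>2) \<partial>P) \<le> ennreal (?R * A / (real n * \<gamma>\<^sup>2))" .
      have "cond_exp P S (\<lambda>xs. L2sq M (\<lambda>x. f x - hatP w \<phi> m n xs f x))
          \<le> ennreal (A + ?R * A / (real n * \<gamma>\<^sup>2) / (1 - \<eta>))"
      proof (rule P.cond_exp_le[where Y = "\<lambda>xs. dot m (b xs) (b xs) / \<gamma>\<^sup>2"])
        show "(\<lambda>xs. dot m (b xs) (b xs) / \<gamma>\<^sup>2) \<in> borel_measurable P"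
          unfolding b_sq using meas by measurable
        show "0 \<le> ?R * A / (real n * \<gamma>\<^sup>2)" using alpha_pos A0 by (intro divide_nonneg_nonneg mult_nonneg_nonneg) auto
      qed (use eta prob_S A0 S_sets int error(2) in simp_all)
      also have "A + ?R * A / (real n * \<gamma>\<^sup>2) / (1 - \<eta>)
          = (1 + (1 / \<alpha>) * (real m / real n) * (1 / (1 - \<eta>)) * (1 / (1 - \<delta>))\<^sup>2) * A"
        by (simp add: \<gamma>_def distrib_left distrib_right power_divide ac_simps)
      also have "ennreal \<dots> \<le> ennreal ((1 + (1 / \<alpha>) * (real m / real n) * (1 / (1 - \<eta>)) * (1 / (1 - \<delta>))\<^sup>2)
             * (INF g\<in>Vm \<phi> m. L2sq M (\<lambda>x. f x - g x)))"
        using eta alpha_pos by (intro inf_mult add_nonneg_nonneg mult_nonneg_nonneg) auto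
      finally show ?thesis .
    qed
  qed
qed

end
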